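(* Let $\Delta_m=(\Delta_m x,\Delta_m t)$ be a sequence of admissible pairs with $\Delta_m\to0$ and $\lim_m\frac{\Delta_m x}{\Delta_m t}=0$, let $v_m\in B(\Gamma^T_m)$ be the solution of the discrete problem (D) for $\Delta_m$, and let $u:\Gamma\times[0,T]\to\mathbb R$ be a Lipschitz continuous function which is the uniform limit of $v_m$, up to a subsequence, as $\Gamma^T_m\to\Gamma\times[0,T]$. Then at every vertex $x\in\mathbf V$ and every $t_0\in(0,T]$ the function $u$ satisfies: if $$\frac{d}{dt}\psi(t_0)<c_x$$ for some $C^1$ subtangent $\psi$ to $u(x,\cdot)$ at $t_0$, then there is an arc $\gamma\in\mathbf E^+_x$ such that all the $C^1$ subtangents $\varphi$, constrained to $[0,|\gamma|]\times[0,T]$, to $u\circ\gamma$ at $(\gamma^{-1}(x),t_0)$ satisfy $$\varphi_t(\gamma^{-1}(x),t_0)+H_\gamma(\gamma^{-1}(x),\varphi'(\gamma^{-1}(x),t_0))\ge0.$$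
   Context: NETWORK. $\Gamma=\bigcup_{\gamma\in\mathbf E}\gamma([0,|\gamma|])\subset\mathbb R^N$, where $\mathbf E$ is a finite collection of regular simple curves (arcs) parametrized by arc length on $[0,|\gamma|]$, $|\gamma|$ being the Euclidean length. If $\gamma\in\mathbf E$, the reversed arc $\widetilde\gamma(t)=\gamma(|\gamma|-t)$ is in $\mathbf E$. Arcs with different supports intersect only at initial/final points, called vertices; $\mathbf V$ is the (finite) set of vertices. $\Gamma$ is connected and there are no self-loops (arcs with coinciding endpoints). An orientation $\mathbf E^+\subset\mathbf E$, containing exactly one arc of each pair $\{\gamma,\widetilde\gamma\}$, is fixed; for $x\in\Gamma$, $\mathbf E^+_x$ is the set of $\gamma\in\mathbf E^+$ whose support contains $x$. $\Gamma$ carries the path-length (geodesic) distance induced by the Euclidean one. For a function $u$ on $\Gamma\times[0,T]$ (or on a discrete subset), $u\circ\gamma(s,t)=u(\gamma(s),t)$. HAMILTONIANS. For each arc $\gamma$, $\widetilde H_\gamma:[0,|\gamma|]\times\mathbb R\to\mathbb R$ is continuous, convex in $\mu$, superlinear in $\mu$ uniformly in $s$, $s\mapsto \widetilde H_\gamma(s,\mu)$ is Lipschitz continuous for every $\mu$, and $\widetilde H_\gamma$ is locally Lipschitz in $[0,|\gamma|]\times\mathbb R$; moreover $\widetilde H_{\widetilde\gamma}(s,\mu)=\widetilde H_\gamma(|\gamma|-s,-\mu)$. Set $\widetilde c_\gamma=-\max_s\min_\mu\widetilde H_\gamma(s,\mu)$. A flux limiter is a function $x\mapsto c_x$ from $\mathbf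 V$ to $\mathbb R$ with $c_x\le\min_{\gamma\in\mathbf E^+_x}\widetilde c_\gamma$; one is fixed. $g:\Gamma\to\mathbb R$ is Lipschitz, $T>0$. TEST FUNCTIONS. A $C^1$ subtangent at a point is a $C^1$ viscosity test function from below. For $C\subset[0,|\gamma|]\times[0,T]$ closed, a subtangent $\varphi$ to $w$ at a point of $\partial C$ is constrained to $C$ if that point minimizes $w-\varphi$ in the intersection of $C$ with a neighborhood of it. $\varphi_t$, $\varphi'$ are time and space derivatives. MODIFIED HAMILTONIANS/LAGRANGIANS. Let $\widetilde M_0=\max_\gamma\min\{m: \widetilde H_\gamma(s,(g\circ\gamma)'(s))\le m \text{ for a.e. } s\}$. Fix a compact interval $I$ such that every $\mu_0\notin I$ satisfies $|\mu_0|>\max_\gamma \mathrm{Lip}(g\circ\gamma)$ and $\widetilde H_\gamma(s,\mu)>\max\{\widetilde M_0+1,\max_{x\in\mathbf V}|c_x|\}$ for all $|\mu|\ge|\mu_0|$, all $\gamma$ and all $s\in[0,|\gamma|]$. Let $\widetilde I$ be a compact neighborhood of $I$, $\beta$ a Lipschitz constant of all $\widetilde H_\gamma$ on $[0,|\gamma|]\times\widetilde I$, fix $\beta_0>\beta$, and $\bar\mu>0$ such that for all $\gamma$, $s$: $\widetilde H_\gamma(s,\mu)>\widetilde H_\gamma(s,-\bar\mu)-\beta_0(\mu+\bar\mu)$ for $\mu<-\bar\mu$, and $\widetilde H_\gamma(s,\mu)>\widetilde H_\gamma(s,\bar\mu)+\beta_0(\mu-\bar\mu)$ for $\mu>\bar\mu$.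 Let $H_{0,\gamma}(s,\mu)$ equal $\widetilde H_\gamma(s,\mu)$ if $|\mu|\le\bar\mu$, $\widetilde H_\gamma(s,-\bar\mu)-\beta_0(\mu+\bar\mu)$ if $\mu<-\bar\mu$, $\widetilde H_\gamma(s,\bar\mu)+\beta_0(\mu-\bar\mu)$ if $\mu>\bar\mu$. $H_\gamma(s,\cdot)$ is the convex envelope of $H_{0,\gamma}(s,\cdot)$ and $L_\gamma(s,\lambda)=\sup_\mu(\mu\lambda-H_\gamma(s,\mu))$. (So $L_\gamma=+\infty$ for $|\lambda|>\beta_0$ and $L_\gamma$ is finite and Lipschitz on $[0,|\gamma|]\times[-\beta_0,\beta_0]$.) DISCRETIZATION. A pair $\Delta=(\Delta x,\Delta t)$ is admissible if $0<\Delta x<|\gamma|$ for all $\gamma\in\mathbf E^+$, $0<\Delta t<T$, $\Delta x\le\Delta t$. Set $N_\gamma=\lceil|\gamma|/\Delta x\rceil$, $N_T=\lceil T/\Delta t\rceil$, $s^\gamma_i=i|\gamma|/N_\gamma$ ($0\le i\le N_\gamma$), $t_n=nT/N_T$ ($0\le n\le N_T$), $\mathcal S_\gamma=\{s_i^\gamma\}$, $\mathcal T=\{t_n\}$, $\Gamma^T_\gamma=\mathcal S_\gamma\times\mathcal T$, $\Gamma^T=\bigcup_{\gamma\in\mathbf E^+}\gamma(\mathcal S_\gamma)\times\mathcal T$; $B(\cdot)$ denotes the real functions on these sets; an index $m$ indicates dependence on $\Delta_m$. For $w\in B(\Gamma^T_\gamma)$, $I_\gamma[w](\cdot,t)$ is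 the piecewise linear interpolation of $w(\cdot,t)$ in $[0,|\gamma|]$ with nodes $\mathcal S_\gamma$, and $$S_\gamma[w](s,t)=\min_{\frac{s-|\gamma|}{\Delta t}\le\alpha\le\frac{s}{\Delta t}}\{I_\gamma[w](s-\Delta t\,\alpha,t)+\Delta t\,L_\gamma(s,\alpha)\}.$$ For $v\in B(\Gamma^T)$: $S[v](x,t)=S_\gamma[v\circ\gamma](\gamma^{-1}(x),t)$ if $x\notin\mathbf V$ ($\gamma$ the unique element of $\mathbf E_x^+$), and $S[v](x,t)=\min\{\min_{\gamma\in\mathbf E^+_x}S_\gamma[v\circ\gamma](\gamma^{-1}(x),t),\ v(x,t)+c_x\Delta t\}$ if $x\in\mathbf V$. Problem (D): $v(x,0)=g(x)$, and $v(x,t_{n})=S[v](x,t_{n-1})$ for $n=1,\dots,N_T$. CONVERGENCE. For subsets $Y_m$ of a metric space $Y$, $Y_m\to Y$ means every $y\in Y$ is the limit of some sequence $y_m\in Y_m$; then $v_m:Y_m\to\mathbb R$ uniformly converges to $v:Y\to\mathbb R$ if $v_m(y_m)\to v(y)$ whenever $y_m\in Y_m$, $y_m\to y\in Y$. *)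

theory Defs
  imports "HOL-Analysis.Analysis"
begin

section \<open>Networks\<close>

text \<open>A curve on \<open>[0, alen]\<close>. The parametrization is kept extensional (see \<open>regular_arc\<close>), so that
  two records are equal exactly when they describe the same parametrized curve.\<close>

record 'a net_arc =
  alen :: real
  amap :: "real \<Rightarrow> 'a"

definition reverse_arc :: "'a net_arc \<Rightarrow> 'a net_arc" where
  "reverse_arc \<gamma> = \<lparr>alen = alen \<gamma>, amap = restrict (\<lambda>t. amap \<gamma> (alen \<gamma> - t)) {0..alen \<gamma>}\<rparr>"

definition support :: "'a net_arc \<Rightarrow> 'a set" where
  "support \<gamma> = amap \<gamma> ` {0..alen \<gamma>}"

definition end_points :: "'a net_arc \<Rightarrow> 'a set" where
  "end_points \<gamma> = {amap \<gamma> 0, amap \<gamma> (alen \<gamma>)}"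

text \<open>Regular means \<open>C\<^sup>1\<close> up to the end points with nonvanishing velocity; arc length parametrization
  means unit speed, which makes \<open>alen\<close> the Euclidean length. Injectivity on the closed interval
  expresses that the curve is simple and that it is not a self-loop.\<close>

definition regular_arc :: "'a::euclidean_space net_arc \<Rightarrow> bool" where
  "regular_arc \<gamma> \<longleftrightarrow>
     0 < alen \<gamma> \<and>
     amap \<gamma> \<in> extensional {0..alen \<gamma>} \<and>
     inj_on (amap \<gamma>) {0..alen \<gamma>} \<and>
     (\<exists>D. continuous_on {0..alen \<gamma>} D \<and>
          (\<forall>s\<in>{0..alen \<gamma>}. (amap \<gamma> has_vector_derivative D s) (at s within {0..alen \<gamma>}) \<and>
                           norm (D s) = 1))"

definition net_points :: "'a net_arc set \<Rightarrow> 'a set" where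
  "net_points E = (\<Union>\<gamma>\<in>E. support \<gamma>)"

definition net_vertices :: "'a net_arc set \<Rightarrow> 'a set" where
  "net_vertices E = (\<Union>\<gamma>\<in>E. end_points \<gamma>)"

definition network :: "'a::euclidean_space net_arc set \<Rightarrow> bool" where
  "network E \<longleftrightarrow>
     finite E \<and>
     (\<forall>\<gamma>\<in>E. regular_arc \<gamma> \<and> reverse_arc \<gamma> \<in> E) \<and>
     (\<forall>\<gamma>\<in>E. \<forall>\<eta>\<in>E. support \<gamma> \<noteq> support \<eta> \<longrightarrow>
        support \<gamma> \<inter> support \<eta> \<subseteq> end_points \<gamma> \<inter> end_points \<eta>) \<and>
     connected (net_points E)"

definition orientation :: "'a net_arc set \<Rightarrow> 'a net_arc set \<Rightarrow> bool" where
  "orientation E Ep \<longleftrightarrow> Ep \<subseteq> E \<and> (\<forall>\<gamma>\<in>E. (\<gamma> \<in> Ep) \<noteq> (reverse_arc \<gamma> \<in> Ep))"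

definition arcs_at :: "'a net_arc set \<Rightarrow> 'a \<Rightarrow> 'a net_arc set" where
  "arcs_at Ep x = {\<gamma>\<in>Ep. x \<in> support \<gamma>}"

definition arc_inv :: "'a net_arc \<Rightarrow> 'a \<Rightarrow> real" where
  "arc_inv \<gamma> x = the_inv_into {0..alen \<gamma>} (amap \<gamma>) x"

definition pullback :: "('a \<times> real \<Rightarrow> real) \<Rightarrow> 'a net_arc \<Rightarrow> real \<times> real \<Rightarrow> real" where
  "pullback u \<gamma> = (\<lambda>(s, t). u (amap \<gamma> s, t))"

text \<open>Length of a path on \<open>[0,1]\<close>: supremum of the lengths of the inscribed polygonals.\<close>

definition curve_length :: "(real \<Rightarrow> 'a::metric_space) \<Rightarrow> ennreal" where
  "curve_length p =
     (SUP ts\<in>{ts. sorted ts \<and> set ts \<subseteq> {0..1}}.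
        \<Sum>i<length ts - 1. ennreal (dist (p (ts ! i)) (p (ts ! Suc i))))"

definition geo_dist :: "'a::euclidean_space net_arc set \<Rightarrow> 'a \<Rightarrow> 'a \<Rightarrow> real" where
  "geo_dist E x y =
     enn2real (INF p\<in>{p. path p \<and> path_image p \<subseteq> net_points E \<and> pathstart p = x \<and> pathfinish p = y}.
       curve_length p)"

definition geo_time_dist ::
    "'a::euclidean_space net_arc set \<Rightarrow> 'a \<times> real \<Rightarrow> 'a \<times> real \<Rightarrow> real" where
  "geo_time_dist E p q = geo_dist E (fst p) (fst q) + \<bar>snd p - snd q\<bar>"

definition lipschitz_wrt :: "('p \<Rightarrow> 'p \<Rightarrow> real) \<Rightarrow> 'p set \<Rightarrow> ('p \<Rightarrow> real) \<Rightarrow> bool" where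
  "lipschitz_wrt d Y f \<longleftrightarrow> (\<exists>K. \<forall>p\<in>Y. \<forall>q\<in>Y. \<bar>f p - f q\<bar> \<le> K * d p q)"


section \<open>Convergence\<close>

definition sets_converge :: "('p \<Rightarrow> 'p \<Rightarrow> real) \<Rightarrow> (nat \<Rightarrow> 'p set) \<Rightarrow> 'p set \<Rightarrow> bool" where
  "sets_converge d Ys Y \<longleftrightarrow>
     (\<forall>y\<in>Y. \<exists>ys. (\<forall>m. ys m \<in> Ys m) \<and> (\<lambda>m. d (ys m) y) \<longlonglongrightarrow> 0)"

definition converges_uniformly ::
    "('p \<Rightarrow> 'p \<Rightarrow> real) \<Rightarrow> (nat \<Rightarrow> 'p set) \<Rightarrow> (nat \<Rightarrow> 'p \<Rightarrow> real) \<Rightarrow> 'p set \<Rightarrow> ('p \<Rightarrow> real) \<Rightarrow> bool" where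
  "converges_uniformly d Ys vs Y v \<longleftrightarrow>
     sets_converge d Ys Y \<and>
     (\<forall>ys. \<forall>y\<in>Y. (\<forall>m. ys m \<in> Ys m) \<and> (\<lambda>m. d (ys m) y) \<longlonglongrightarrow> 0 \<longrightarrow> (\<lambda>m. vs m (ys m)) \<longlonglongrightarrow> v y)"


section \<open>Hamiltonians and flux limiters\<close>

type_synonym 'a hamiltonian = "'a net_arc \<Rightarrow> real \<Rightarrow> real \<Rightarrow> real"

definition locally_lipschitz_on :: "'p::metric_space set \<Rightarrow> ('p \<Rightarrow> real) \<Rightarrow> bool" where
  "locally_lipschitz_on Y f \<longleftrightarrow> (\<forall>p\<in>Y. \<exists>\<epsilon>>0. \<exists>K. K-lipschitz_on (Y \<inter> ball p \<epsilon>) f)"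

definition hamiltonians :: "'a net_arc set \<Rightarrow> 'a hamiltonian \<Rightarrow> bool" where
  "hamiltonians E Ht \<longleftrightarrow> (\<forall>\<gamma>\<in>E.
     continuous_on ({0..alen \<gamma>} \<times> UNIV) (\<lambda>(s, \<mu>). Ht \<gamma> s \<mu>) \<and>
     (\<forall>s\<in>{0..alen \<gamma>}. convex_on UNIV (Ht \<gamma> s)) \<and>
     (\<forall>K. \<exists>R. \<forall>s\<in>{0..alen \<gamma>}. \<forall>\<mu>. R \<le> \<bar>\<mu>\<bar> \<longrightarrow> K * \<bar>\<mu>\<bar> \<le> Ht \<gamma> s \<mu>) \<and>
     (\<forall>\<mu>. \<exists>K. K-lipschitz_on {0..alen \<gamma>} (\<lambda>s. Ht \<gamma> s \<mu>)) \<and>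
     locally_lipschitz_on ({0..alen \<gamma>} \<times> UNIV) (\<lambda>(s, \<mu>). Ht \<gamma> s \<mu>) \<and>
     (\<forall>s\<in>{0..alen \<gamma>}. \<forall>\<mu>. Ht (reverse_arc \<gamma>) s \<mu> = Ht \<gamma> (alen \<gamma> - s) (- \<mu>)))"

text \<open>The extrema below are attained for the Hamiltonians considered, so that \<open>SUP\<close> and \<open>INF\<close> are a
  maximum and a minimum.\<close>

definition crit_value :: "'a hamiltonian \<Rightarrow> 'a net_arc \<Rightarrow> real" where
  "crit_value Ht \<gamma> = - (SUP s\<in>{0..alen \<gamma>}. INF \<mu>. Ht \<gamma> s \<mu>)"

definition flux_limiter ::
    "'a net_arc set \<Rightarrow> 'a net_arc set \<Rightarrow> 'a hamiltonian \<Rightarrow> ('a \<Rightarrow> real) \<Rightarrow> bool" where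
  "flux_limiter E Ep Ht c \<longleftrightarrow>
     (\<forall>x\<in>net_vertices E. c x \<le> Min (crit_value Ht ` arcs_at Ep x))"


section \<open>Modified Hamiltonians and Lagrangians\<close>

definition lip_const :: "'p::metric_space set \<Rightarrow> ('p \<Rightarrow> real) \<Rightarrow> real" where
  "lip_const Y f = Inf {K. K-lipschitz_on Y f}"

definition M0_tilde :: "'a net_arc set \<Rightarrow> 'a hamiltonian \<Rightarrow> ('a \<Rightarrow> real) \<Rightarrow> real" where
  "M0_tilde E Ht g = Max ((\<lambda>\<gamma>. Inf {m. AE s in lborel. s \<in> {0<..<alen \<gamma>} \<longrightarrow>
                                     Ht \<gamma> s (deriv (g \<circ> amap \<gamma>) s) \<le> m}) ` E)"

definition modification_data ::
    "'a net_arc set \<Rightarrow> 'a hamiltonian \<Rightarrow> ('a \<Rightarrow> real) \<Rightarrow> ('a \<Rightarrow> real) \<Rightarrow>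
     real set \<Rightarrow> real set \<Rightarrow> real \<Rightarrow> real \<Rightarrow> real \<Rightarrow> bool" where
  "modification_data E Ht c g J Jt \<beta> \<beta>\<^sub>0 \<mu>b \<longleftrightarrow>
     compact J \<and> is_interval J \<and>
     (\<forall>\<mu>\<^sub>0. \<mu>\<^sub>0 \<notin> J \<longrightarrow>
        \<bar>\<mu>\<^sub>0\<bar> > Max ((\<lambda>\<gamma>. lip_const {0..alen \<gamma>} (g \<circ> amap \<gamma>)) ` E) \<and>
        (\<forall>\<mu>. \<bar>\<mu>\<bar> \<ge> \<bar>\<mu>\<^sub>0\<bar> \<longrightarrow> (\<forall>\<gamma>\<in>E. \<forall>s\<in>{0..alen \<gamma>}.
           Ht \<gamma> s \<mu> > max (M0_tilde E Ht g + 1) (Max ((\<lambda>x. \<bar>c x\<bar>) ` net_vertices E))))) \<and>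
     compact Jt \<and> J \<subseteq> interior Jt \<and>
     (\<forall>\<gamma>\<in>E. \<beta>-lipschitz_on ({0..alen \<gamma>} \<times> Jt) (\<lambda>(s, \<mu>). Ht \<gamma> s \<mu>)) \<and>
     \<beta> < \<beta>\<^sub>0 \<and> 0 < \<mu>b \<and>
     (\<forall>\<gamma>\<in>E. \<forall>s\<in>{0..alen \<gamma>}.
        (\<forall>\<mu>. \<mu> < - \<mu>b \<longrightarrow> Ht \<gamma> s \<mu> > Ht \<gamma> s (- \<mu>b) - \<beta>\<^sub>0 * (\<mu> + \<mu>b)) \<and>
        (\<forall>\<mu>. \<mu> > \<mu>b \<longrightarrow> Ht \<gamma> s \<mu> > Ht \<gamma> s \<mu>b + \<beta>\<^sub>0 * (\<mu> - \<mu>b)))"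

definition H_zero :: "'a hamiltonian \<Rightarrow> real \<Rightarrow> real \<Rightarrow> 'a hamiltonian" where
  "H_zero Ht \<beta>\<^sub>0 \<mu>b \<gamma> s \<mu> =
     (if \<mu> < - \<mu>b then Ht \<gamma> s (- \<mu>b) - \<beta>\<^sub>0 * (\<mu> + \<mu>b)
      else if \<mu> > \<mu>b then Ht \<gamma> s \<mu>b + \<beta>\<^sub>0 * (\<mu> - \<mu>b)
      else Ht \<gamma> s \<mu>)"

definition convex_envelope :: "(real \<Rightarrow> real) \<Rightarrow> real \<Rightarrow> real" where
  "convex_envelope f \<mu> = Sup {h \<mu> |h. convex_on UNIV h \<and> (\<forall>\<nu>. h \<nu> \<le> f \<nu>)}"

definition H_mod :: "'a hamiltonian \<Rightarrow> real \<Rightarrow> real \<Rightarrow> 'a hamiltonian" where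
  "H_mod Ht \<beta>\<^sub>0 \<mu>b \<gamma> s = convex_envelope (H_zero Ht \<beta>\<^sub>0 \<mu>b \<gamma> s)"

type_synonym 'a lagrangian = "'a net_arc \<Rightarrow> real \<Rightarrow> real \<Rightarrow> ereal"

definition L_mod :: "'a hamiltonian \<Rightarrow> real \<Rightarrow> real \<Rightarrow> 'a lagrangian" where
  "L_mod Ht \<beta>\<^sub>0 \<mu>b \<gamma> s l = (SUP \<mu>. ereal (\<mu> * l - H_mod Ht \<beta>\<^sub>0 \<mu>b \<gamma> s \<mu>))"


section \<open>Discretization\<close>

definition admissible :: "'a net_arc set \<Rightarrow> real \<Rightarrow> real \<Rightarrow> real \<Rightarrow> bool" where
  "admissible Ep T dx dt \<longleftrightarrow> 0 < dx \<and> (\<forall>\<gamma>\<in>Ep. dx < alen \<gamma>) \<and> 0 < dt \<and> dt < T \<and> dx \<le> dt"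

definition num_cells :: "'a net_arc \<Rightarrow> real \<Rightarrow> nat" where
  "num_cells \<gamma> dx = nat \<lceil>alen \<gamma> / dx\<rceil>"

definition num_steps :: "real \<Rightarrow> real \<Rightarrow> nat" where
  "num_steps T dt = nat \<lceil>T / dt\<rceil>"

definition node :: "'a net_arc \<Rightarrow> real \<Rightarrow> nat \<Rightarrow> real" where
  "node \<gamma> dx i = real i * alen \<gamma> / real (num_cells \<gamma> dx)"

definition time_node :: "real \<Rightarrow> real \<Rightarrow> nat \<Rightarrow> real" where
  "time_node T dt n = real n * T / real (num_steps T dt)"

definition space_grid :: "'a net_arc set \<Rightarrow> real \<Rightarrow> 'a set" where
  "space_grid Ep dx = (\<Union>\<gamma>\<in>Ep. amap \<gamma> ` node \<gamma> dx ` {0..num_cells \<gamma> dx})"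

definition grid :: "'a net_arc set \<Rightarrow> real \<Rightarrow> real \<Rightarrow> real \<Rightarrow> ('a \<times> real) set" where
  "grid Ep T dx dt = space_grid Ep dx \<times> time_node T dt ` {0..num_steps T dt}"

text \<open>Here \<open>i\<close> is the index of a cell \<open>[s\<^sub>i, s\<^sub>i\<^sub>+\<^sub>1]\<close> containing \<open>s\<close>; the minimum assigns the end point
  \<open>s = |\<gamma>|\<close> to the last cell.\<close>

definition interp :: "'a net_arc \<Rightarrow> real \<Rightarrow> (real \<times> real \<Rightarrow> real) \<Rightarrow> real \<Rightarrow> real \<Rightarrow> real" where
  "interp \<gamma> dx w s t =
     (let h = alen \<gamma> / real (num_cells \<gamma> dx);
          i = min (num_cells \<gamma> dx - 1) (nat \<lfloor>s / h\<rfloor>);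
          a = node \<gamma> dx i;
          b = node \<gamma> dx (Suc i)
      in w (a, t) + (s - a) / h * (w (b, t) - w (a, t)))"

text \<open>The infimum is a finite minimum: \<open>\<alpha> = 0\<close> is an admissible choice, where the Lagrangian is finite.\<close>

definition S_arc ::
    "'a lagrangian \<Rightarrow> real \<Rightarrow> real \<Rightarrow> 'a net_arc \<Rightarrow> (real \<times> real \<Rightarrow> real) \<Rightarrow> real \<Rightarrow> real \<Rightarrow> real" where
  "S_arc L dx dt \<gamma> w s t =
     real_of_ereal (INF \<alpha>\<in>{(s - alen \<gamma>) / dt..s / dt}.
       ereal (interp \<gamma> dx w (s - dt * \<alpha>) t) + ereal dt * L \<gamma> s \<alpha>)"

definition S_net ::
    "'a net_arc set \<Rightarrow> 'a net_arc set \<Rightarrow> ('a \<Rightarrow> real) \<Rightarrow> 'a lagrangian \<Rightarrow> real \<Rightarrow> real \<Rightarrow>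
     ('a \<times> real \<Rightarrow> real) \<Rightarrow> 'a \<Rightarrow> real \<Rightarrow> real" where
  "S_net E Ep c L dx dt v x t =
     (if x \<in> net_vertices E
      then min (Min ((\<lambda>\<gamma>. S_arc L dx dt \<gamma> (pullback v \<gamma>) (arc_inv \<gamma> x) t) ` arcs_at Ep x))
               (v (x, t) + c x * dt)
      else let \<gamma> = (THE \<gamma>. \<gamma> \<in> arcs_at Ep x) in S_arc L dx dt \<gamma> (pullback v \<gamma>) (arc_inv \<gamma> x) t)"

text \<open>Elements of \<open>B(\<Gamma>\<^sup>T)\<close> are represented by functions on the whole type, of which only the values on
  \<open>grid Ep T dx dt\<close> are ever used.\<close>

definition discrete_solution ::
    "'a net_arc set \<Rightarrow> 'a net_arc set \<Rightarrow> ('a \<Rightarrow> real) \<Rightarrow> 'a lagrangian \<Rightarrow> ('a \<Rightarrow> real) \<Rightarrow> real \<Rightarrow>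
     real \<Rightarrow> real \<Rightarrow> ('a \<times> real \<Rightarrow> real) \<Rightarrow> bool" where
  "discrete_solution E Ep c L g T dx dt v \<longleftrightarrow>
     (\<forall>x\<in>space_grid Ep dx. v (x, 0) = g x) \<and>
     (\<forall>n\<in>{1..num_steps T dt}. \<forall>x\<in>space_grid Ep dx.
        v (x, time_node T dt n) = S_net E Ep c L dx dt v x (time_node T dt (n - 1)))"


section \<open>Test functions\<close>

definition C1_on :: "'p::real_normed_vector set \<Rightarrow> ('p \<Rightarrow> real) \<Rightarrow> bool" where
  "C1_on U f \<longleftrightarrow> (\<exists>f' :: 'p \<Rightarrow> 'p \<Rightarrow>\<^sub>L real. continuous_on U f' \<and>
     (\<forall>p\<in>U. (f has_derivative blinfun_apply (f' p)) (at p)))"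

text \<open>Subtangent to \<open>w\<close> at \<open>p\<close> relative to \<open>C\<close>: the difference \<open>w - \<phi>\<close> attains its minimum over \<open>C\<close> near
  \<open>p\<close>, while \<open>\<phi>\<close> itself is \<open>C\<^sup>1\<close> in a full neighborhood of \<open>p\<close>. If \<open>C\<close> is the domain of \<open>w\<close> this is the
  plain notion of subtangent; if \<open>p\<close> lies on the boundary of \<open>C\<close> it is the constrained one.\<close>

definition C1_subtangent ::
    "'p::real_normed_vector set \<Rightarrow> ('p \<Rightarrow> real) \<Rightarrow> 'p \<Rightarrow> ('p \<Rightarrow> real) \<Rightarrow> bool" where
  "C1_subtangent C w p \<phi> \<longleftrightarrow> p \<in> C \<and>
     (\<exists>U. open U \<and> p \<in> U \<and> C1_on U \<phi> \<and> (\<forall>q\<in>C \<inter> U. w p - \<phi> p \<le> w q - \<phi> q))"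

end

theory Submission
  imports Defs
begin

text \<open>Suppose that the conclusion fails at \<open>(x, t\<^sub>0)\<close>: some \<open>\<psi>\<close> touching \<open>u(x, \<sqdot>)\<close> from below has
  slope less than \<open>c\<^sub>x\<close>, and on every arc \<open>\<gamma>\<close> at \<open>x\<close> some constrained subtangent \<open>\<phi>\<close> has
  \<open>\<phi>\<^sub>t + H\<^sub>\<gamma>(\<sigma>, \<phi>') < 0\<close>, where \<open>\<gamma>(\<sigma>) = x\<close>. The contradiction is obtained for the discrete
  solutions themselves, on a fine grid.

  Fix \<open>\<psi>'(t\<^sub>0) < c' < c\<^sub>x\<close> and let \<open>t\<^sub>k\<close> be the time node near \<open>t\<^sub>0\<close>, not later than \<open>t\<^sub>0\<close>, that
  minimizes \<open>v(x, t) - c' t\<close>; such nodes converge to \<open>t\<^sub>0\<close> (\<open>contact_times\<close>). Minimality bounds the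
  increment of \<open>v(x, \<sqdot>)\<close> in the step that ends at \<open>t\<^sub>k\<close> by \<open>c'\<close> times the step, so the candidate
  \<open>v(x, t) + c\<^sub>x \<Delta>t\<close> in the update is too large, and the value \<open>v(x, t\<^sub>k)\<close> must be that of the
  update along some arc. It remains to show that every arc update exceeds \<open>v(x, t\<^sub>k)\<close>
  (\<open>arc_update_exceeds\<close>).

  A discrete optimal path that runs backwards from \<open>(x, t\<^sub>k)\<close> into \<open>\<gamma>\<close> either stays away from \<open>x\<close>
  or returns to \<open>x\<close>. The first kind is excluded by \<open>\<phi>\<close>. The second kind is too expensive because
  the flux limiter condition provides a slope \<open>\<mu>\<^sub>0\<close> with \<open>H\<^sub>\<gamma>(\<sigma>, \<mu>\<^sub>0) < - c'\<close> (\<open>flux_slope\<close>): a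
  return to \<open>x\<close> costs more than \<open>c'\<close> per unit of time, against the choice of \<open>t\<^sub>k\<close>. Both effects
  are captured by one lower barrier, the minimum of finitely many functions
  \<open>l (t - t\<^sub>k) + m (s - \<sigma>)\<close>: the pair \<open>(c', \<mu>\<^sub>0)\<close>, and pairs \<open>(\<phi>\<^sub>t + \<epsilon>, \<phi>' \<plusminus> \<epsilon>)\<close>, whose minimum
  lies strictly below the first order expansion of \<open>\<phi>\<close> at earlier times. Each pair satisfies
  \<open>l + H\<^sub>\<gamma>(s, m) < 0\<close> near \<open>\<sigma>\<close>.
  As the scheme takes an infimum, it preserves such minima of strict subsolutions, up to an
  interpolation error \<open>O(\<Delta>x)\<close> and an error caused by the actual time step \<open>T / N\<^sub>T\<close> being smaller
  than \<open>\<Delta>t\<close>; both are \<open>o(\<Delta>t)\<close> and are absorbed by the strictness (\<open>S_arc_gt_roof\<close>). An induction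
  on the time nodes keeps \<open>v\<close> above the barrier: far from \<open>(\<sigma>, t\<^sub>0)\<close> by uniform convergence, at
  \<open>x\<close> by the choice of \<open>t\<^sub>k\<close>, elsewhere by the one step estimate.\<close>

section \<open>Arcs and the geodesic distance\<close>

lemma unit_speed_quotient:
  assumes "regular_arc \<gamma>" "s \<in> {0..alen \<gamma>}"
  shows "((\<lambda>r. norm (amap \<gamma> r - amap \<gamma> s) / \<bar>r - s\<bar>) \<longlongrightarrow> 1) (at s within {0..alen \<gamma>})"
proof -
  obtain D where D: "(amap \<gamma> has_vector_derivative D) (at s within {0..alen \<gamma>})" "norm D = 1"
    using assms unfolding regular_arc_def by blast
  let ?R = "\<lambda>r. (1 / norm (r - s)) *\<^sub>R (amap \<gamma> r - (amap \<gamma> s + (r - s) *\<^sub>R D))"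
  have "(?R \<longlongrightarrow> 0) (at s within {0..alen \<gamma>})"
    using D(1) by (simp add: has_vector_derivative_def has_derivative_within)
  from tendsto_norm_zero[OF this]
  have lim: "((\<lambda>r. norm (?R r)) \<longlongrightarrow> 0) (at s within {0..alen \<gamma>})" .
  have bound: "norm (norm (amap \<gamma> r - amap \<gamma> s) / \<bar>r - s\<bar> - 1) \<le> norm (?R r)" if "r \<noteq> s" for r
  proof -
    have "\<bar>norm (amap \<gamma> r - amap \<gamma> s) - norm ((r - s) *\<^sub>R D)\<bar>
        \<le> norm (amap \<gamma> r - amap \<gamma> s - (r - s) *\<^sub>R D)"
      by (rule norm_triangle_ineq3)
    then have "\<bar>norm (amap \<gamma> r - amap \<gamma> s) - \<bar>r - s\<bar>\<bar> / \<bar>r - s\<bar>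
        \<le> norm (amap \<gamma> r - amap \<gamma> s - (r - s) *\<^sub>R D) / \<bar>r - s\<bar>"
      using that by (intro divide_right_mono) (simp_all add: D(2))
    moreover have "norm (amap \<gamma> r - amap \<gamma> s) / \<bar>r - s\<bar> - 1
        = (norm (amap \<gamma> r - amap \<gamma> s) - \<bar>r - s\<bar>) / \<bar>r - s\<bar>"
      using that by (simp add: diff_divide_distrib)
    ultimately show ?thesis
      by (simp add: abs_divide diff_diff_eq)
  qed
  have "((\<lambda>r. norm (amap \<gamma> r - amap \<gamma> s) / \<bar>r - s\<bar> - 1) \<longlongrightarrow> 0) (at s within {0..alen \<gamma>})"
  proof (rule Lim_null_comparison[OF _ lim])
    show "\<forall>\<^sub>F r in at s within {0..alen \<gamma>}.
        norm (norm (amap \<gamma> r - amap \<gamma> s) / \<bar>r - s\<bar> - 1) \<le> norm (?R r)"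
      unfolding eventually_at_filter by (rule always_eventually) (use bound in blast)
  qed
  then show ?thesis by (simp add: LIM_zero_iff)
qed

lemma arc_dist_le:
  assumes "regular_arc \<gamma>" "a \<in> {0..alen \<gamma>}" "b \<in> {0..alen \<gamma>}"
  shows "dist (amap \<gamma> a) (amap \<gamma> b) \<le> \<bar>a - b\<bar>"
proof -
  obtain D where D: "\<And>s. s \<in> {0..alen \<gamma>} \<Longrightarrow> (amap \<gamma> has_vector_derivative D s) (at s within {0..alen \<gamma>})"
    "\<And>s. s \<in> {0..alen \<gamma>} \<Longrightarrow> norm (D s) = 1"
    using assms(1) unfolding regular_arc_def by blast
  have "norm (amap \<gamma> a - amap \<gamma> b) \<le> 1 * norm (a - b)"
  proof (rule differentiable_bound[where S = "{0..alen \<gamma>}"])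
    show "(amap \<gamma> has_derivative (\<lambda>h. h *\<^sub>R D s)) (at s within {0..alen \<gamma>})"
      if "s \<in> {0..alen \<gamma>}" for s
      using D(1)[OF that] by (simp add: has_vector_derivative_def)
    show "onorm (\<lambda>h. h *\<^sub>R D s) \<le> 1" if "s \<in> {0..alen \<gamma>}" for s
      by (rule onorm_le) (simp add: D(2)[OF that])
  qed (use assms in auto)
  then show ?thesis
    by (simp add: dist_norm)
qed

lemma continuous_on_arc:
  assumes "regular_arc \<gamma>"
  shows "continuous_on {0..alen \<gamma>} (amap \<gamma>)"
  using assms unfolding regular_arc_def
  by (meson continuous_on_eq_continuous_within has_vector_derivative_continuous)

text \<open>Unit speed makes the curve 1-Lipschitz, so the length of every inscribed polygonal telescopes.\<close>

lemma curve_length_segment_le: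
  assumes "regular_arc \<gamma>" "a \<in> {0..alen \<gamma>}" "b \<in> {0..alen \<gamma>}"
  shows "curve_length (\<lambda>r. amap \<gamma> (a + r * (b - a))) \<le> ennreal \<bar>a - b\<bar>"
  unfolding curve_length_def
proof (rule SUP_least)
  fix ts :: "real list"
  assume "ts \<in> {ts. sorted ts \<and> set ts \<subseteq> {0..1}}"
  then have ts: "sorted ts" "set ts \<subseteq> {0..1}" by auto
  let ?p = "\<lambda>r. amap \<gamma> (a + r * (b - a))"
  have inside: "a + r * (b - a) \<in> {0..alen \<gamma>}" if "r \<in> {0..1}" for r
  proof -
    have "(1 - r) *\<^sub>R a + r *\<^sub>R b \<in> {0..alen \<gamma>}"
      using that assms(2,3) by (intro convexD) auto
    then show ?thesis by (simp add: algebra_simps)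
  qed
  let ?n = "length ts - 1"
  have step: "dist (?p (ts ! i)) (?p (ts ! Suc i)) \<le> \<bar>a - b\<bar> * (ts ! Suc i - ts ! i)"
    if "i < ?n" for i
  proof -
    have mem: "ts ! i \<in> {0..1}" "ts ! Suc i \<in> {0..1}"
      using that subsetD[OF ts(2) nth_mem[of i]] subsetD[OF ts(2) nth_mem[of "Suc i"]] by auto
    have "ts ! i \<le> ts ! Suc i"
      using ts(1) that by (simp add: sorted_nth_mono)
    moreover have "dist (?p (ts ! i)) (?p (ts ! Suc i))
        \<le> \<bar>(a + ts ! i * (b - a)) - (a + ts ! Suc i * (b - a))\<bar>"
      by (rule arc_dist_le[OF assms(1) inside[OF mem(1)] inside[OF mem(2)]])
    moreover have "(a + ts ! i * (b - a)) - (a + ts ! Suc i * (b - a)) = (a - b) * (ts ! Suc i - ts ! i)"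
      by (simp add: algebra_simps)
    ultimately show ?thesis by (simp add: abs_mult)
  qed
  have "(\<Sum>i<?n. ennreal (dist (?p (ts ! i)) (?p (ts ! Suc i))))
      = ennreal (\<Sum>i<?n. dist (?p (ts ! i)) (?p (ts ! Suc i)))"
    by (simp add: sum_ennreal)
  also have "\<dots> \<le> ennreal (\<Sum>i<?n. \<bar>a - b\<bar> * (ts ! Suc i - ts ! i))"
    by (intro ennreal_leI sum_mono step) auto
  also have "(\<Sum>i<?n. \<bar>a - b\<bar> * (ts ! Suc i - ts ! i)) = \<bar>a - b\<bar> * (ts ! ?n - ts ! 0)"
    by (simp add: sum_distrib_left[symmetric] sum_lessThan_telescope)
  also have "ennreal (\<bar>a - b\<bar> * (ts ! ?n - ts ! 0)) \<le> ennreal \<bar>a - b\<bar>"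
  proof (cases "ts = []")
    case False
    then have "ts ! ?n \<le> 1" "0 \<le> ts ! 0"
      using subsetD[OF ts(2) nth_mem[of ?n]] subsetD[OF ts(2) nth_mem[of 0]] by auto
    then show ?thesis
      by (intro ennreal_leI) (simp add: mult_left_le)
  qed simp
  finally show "(\<Sum>i<?n. ennreal (dist (?p (ts ! i)) (?p (ts ! Suc i)))) \<le> ennreal \<bar>a - b\<bar>" .
qed

lemma geo_dist_arc_le:
  assumes "\<gamma> \<in> E" "regular_arc \<gamma>" "a \<in> {0..alen \<gamma>}" "b \<in> {0..alen \<gamma>}"
  shows "geo_dist E (amap \<gamma> a) (amap \<gamma> b) \<le> \<bar>a - b\<bar>"
proof -
  let ?p = "\<lambda>r. amap \<gamma> (a + r * (b - a))"
  have inside: "(\<lambda>r. a + r * (b - a)) ` {0..1} \<subseteq> {0..alen \<gamma>}"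
  proof
    fix y assume "y \<in> (\<lambda>r. a + r * (b - a)) ` {0..1}"
    then obtain r where r: "r \<in> {0..1}" "y = a + r * (b - a)" by blast
    have "(1 - r) *\<^sub>R a + r *\<^sub>R b \<in> {0..alen \<gamma>}"
      using r assms(3,4) by (intro convexD) auto
    then show "y \<in> {0..alen \<gamma>}" by (simp add: r(2) algebra_simps)
  qed
  have "continuous_on {0..1} ?p"
    by (rule continuous_on_compose2[OF continuous_on_arc[OF assms(2)] _ inside])
       (intro continuous_intros)
  then have "path ?p" by (simp add: path_def)
  moreover have "path_image ?p \<subseteq> net_points E"
    using inside assms(1) by (auto simp: path_image_def net_points_def support_def)
  moreover have "pathstart ?p = amap \<gamma> a" "pathfinish ?p = amap \<gamma> b"
    by (simp_all add: pathstart_def pathfinish_def)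
  ultimately have "(INF p\<in>{p. path p \<and> path_image p \<subseteq> net_points E \<and> pathstart p = amap \<gamma> a
      \<and> pathfinish p = amap \<gamma> b}. curve_length p) \<le> curve_length ?p"
    by (intro INF_lower) simp
  also have "\<dots> \<le> ennreal \<bar>a - b\<bar>"
    by (rule curve_length_segment_le[OF assms(2-4)])
  finally show ?thesis
    unfolding geo_dist_def by (rule enn2real_leI[rotated]) simp
qed

text \<open>An arc length parametrization is unique up to reversal. The change of parameter
  \<open>h = \<gamma>\<^sup>-\<^sup>1 \<circ> \<eta>\<close> is monotone as an injective continuous function on an interval, and its difference
  quotients are, in absolute value, quotients of two expressions that tend to the unit speeds of \<open>\<eta>\<close>
  and \<open>\<gamma>\<close>. Hence \<open>h' = \<plusminus>1\<close> throughout, with constant sign.\<close>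

lemma same_support_imp_eq_or_reverse:
  assumes g: "regular_arc \<gamma>" and e: "regular_arc \<eta>" and supp: "support \<gamma> = support \<eta>"
  shows "\<eta> = \<gamma> \<or> \<eta> = reverse_arc \<gamma>"
proof -
  let ?A = "{0..alen \<gamma>}" and ?B = "{0..alen \<eta>}"
  define h where "h s = the_inv_into ?A (amap \<gamma>) (amap \<eta> s)" for s
  have pos: "0 < alen \<gamma>" "0 < alen \<eta>" and inj: "inj_on (amap \<gamma>) ?A" "inj_on (amap \<eta>) ?B"
    using g e by (auto simp: regular_arc_def)
  have img: "amap \<gamma> ` ?A = amap \<eta> ` ?B"
    using supp by (simp add: support_def)
  have h_mem: "h s \<in> ?A" and gh: "amap \<gamma> (h s) = amap \<eta> s" if "s \<in> ?B" for s
  proof -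
    have "amap \<eta> s \<in> amap \<gamma> ` ?A" using that img by blast
    then show "h s \<in> ?A" "amap \<gamma> (h s) = amap \<eta> s"
      unfolding h_def
      by (rule the_inv_into_into[OF inj(1) _ subset_refl], rule f_the_inv_into_f[OF inj(1)])
  qed
  have h_inj: "inj_on h ?B"
  proof (rule inj_onI)
    fix r s assume rs: "r \<in> ?B" "s \<in> ?B" "h r = h s"
    then have "amap \<eta> r = amap \<eta> s" using gh[of r] gh[of s] by simp
    then show "r = s" using inj(2) rs by (simp add: inj_on_eq_iff)
  qed
  have h_img: "h ` ?B = ?A"
  proof
    show "?A \<subseteq> h ` ?B"
    proof
      fix a assume a: "a \<in> ?A"
      then have "amap \<gamma> a \<in> amap \<eta> ` ?B" using img by blast
      then obtain s where s: "amap \<gamma> a = amap \<eta> s" "s \<in> ?B" by (rule imageE)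
      then have "h s = a" using the_inv_into_f_f[OF inj(1) a] by (simp only: h_def s(1))
      then show "a \<in> h ` ?B" using s(2) by blast
    qed
  qed (use h_mem in blast)
  have "continuous_on (amap \<gamma> ` ?A) (the_inv_into ?A (amap \<gamma>))"
    using continuous_on_arc[OF g] inj(1) by (intro continuous_on_inv_into) auto
  then have h_cont: "continuous_on ?B h"
    unfolding h_def by (rule continuous_on_compose2[OF _ continuous_on_arc[OF e]]) (simp add: img)
  have quot: "((\<lambda>r. \<bar>h r - h s\<bar> / \<bar>r - s\<bar>) \<longlongrightarrow> 1) (at s within ?B)" if s: "s \<in> ?B" for s
  proof -
    have ev: "\<forall>\<^sub>F r in at s within ?B. r \<in> ?B \<and> h r \<noteq> h s \<and> r \<noteq> s"
      unfolding eventually_at_filter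
      by (rule always_eventually) (use inj_onD[OF h_inj _ _ s] in blast)
    have "filterlim h (at (h s) within ?A) (at s within ?B)"
      unfolding filterlim_at using ev h_mem h_cont s by (auto simp: continuous_on_def elim: eventually_mono)
    from filterlim_compose[OF unit_speed_quotient[OF g h_mem[OF s]] this]
    have "((\<lambda>r. norm (amap \<gamma> (h r) - amap \<gamma> (h s)) / \<bar>h r - h s\<bar>) \<longlongrightarrow> 1) (at s within ?B)" .
    from tendsto_divide[OF unit_speed_quotient[OF e s] this]
    have "((\<lambda>r. (norm (amap \<eta> r - amap \<eta> s) / \<bar>r - s\<bar>) /
       (norm (amap \<gamma> (h r) - amap \<gamma> (h s)) / \<bar>h r - h s\<bar>)) \<longlongrightarrow> 1) (at s within ?B)" by simp
    then show ?thesis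
    proof (rule Lim_transform_eventually)
      show "\<forall>\<^sub>F r in at s within ?B. (norm (amap \<eta> r - amap \<eta> s) / \<bar>r - s\<bar>) /
       (norm (amap \<gamma> (h r) - amap \<gamma> (h s)) / \<bar>h r - h s\<bar>) = \<bar>h r - h s\<bar> / \<bar>r - s\<bar>"
        using ev
      proof eventually_elim
        case (elim r)
        then have "amap \<eta> r \<noteq> amap \<eta> s" using inj_on_eq_iff[OF inj(2) _ s] by blast
        then show ?case using elim gh s by simp
      qed
    qed
  qed
  have "strict_mono_on ?B h \<or> strict_antimono_on ?B h"
    using injective_eq_monotone_map[of ?B h] h_cont h_inj is_interval_cc by blast
  then obtain \<epsilon> :: real where eps: "\<epsilon> = 1 \<or> \<epsilon> = - 1"
    and mono: "\<And>r s. r \<in> ?B \<Longrightarrow> s \<in> ?B \<Longrightarrow> r < s \<Longrightarrow> 0 < \<epsilon> * (h s - h r)"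
  proof
    assume "strict_mono_on ?B h"
    then show ?thesis by (intro that[of 1]) (auto simp: monotone_on_def)
  next
    assume "strict_antimono_on ?B h"
    then show ?thesis by (intro that[of "-1"]) (auto simp: monotone_on_def)
  qed
  have sq: "\<epsilon> * \<epsilon> = 1" using eps by auto
  have "((\<lambda>r. \<epsilon> * h r - r) has_real_derivative 0) (at s within ?B)" if s: "s \<in> ?B" for s
  proof -
    have eq: "\<bar>h r - h s\<bar> / \<bar>r - s\<bar> = (\<epsilon> * h r - \<epsilon> * h s) / (r - s)" if r: "r \<in> ?B" for r
    proof (cases r s rule: linorder_cases)
      case less
      then show ?thesis using mono[OF r s less] eps by (auto simp: divide_simps algebra_simps)
    next
      case greater
      then show ?thesis using mono[OF s r greater] eps by (auto simp: divide_simps algebra_simps)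
    qed simp
    have "((\<lambda>r. (\<epsilon> * h r - \<epsilon> * h s) / (r - s)) \<longlongrightarrow> 1) (at s within ?B)"
      using quot[OF s] proof (rule Lim_transform_eventually)
      show "\<forall>\<^sub>F r in at s within ?B. \<bar>h r - h s\<bar> / \<bar>r - s\<bar> = (\<epsilon> * h r - \<epsilon> * h s) / (r - s)"
        unfolding eventually_at_filter by (rule always_eventually) (use eq in blast)
    qed
    then have "((\<lambda>r. \<epsilon> * h r) has_real_derivative 1) (at s within ?B)"
      by (simp add: has_field_derivative_iff)
    from DERIV_diff[OF this DERIV_ident] show ?thesis by simp
  qed
  then have "\<exists>k. \<forall>s\<in>?B. \<epsilon> * h s - s = k"
    by (intro has_field_derivative_zero_constant) auto
  then obtain k where k: "\<And>s. s \<in> ?B \<Longrightarrow> \<epsilon> * h s - s = k" by blast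
  have aff: "h s = h 0 + \<epsilon> * s" if "s \<in> ?B" for s
  proof -
    have "\<epsilon> * (\<epsilon> * h s - s) = \<epsilon> * (\<epsilon> * h 0 - 0)"
      using k[OF that] k[of 0] pos by simp
    then show ?thesis using sq by (simp add: algebra_simps flip: mult.assoc)
  qed
  have ends: "h 0 \<in> ?A" "h (alen \<eta>) = h 0 + \<epsilon> * alen \<eta>" "h (alen \<eta>) \<in> ?A"
    using h_mem[of 0] h_mem[of "alen \<eta>"] aff[of "alen \<eta>"] pos by simp_all
  have "0 \<in> h ` ?B" "alen \<gamma> \<in> h ` ?B"
    unfolding h_img using pos by auto
  then obtain s0 s1 where s01: "s0 \<in> ?B" "0 = h 0 + \<epsilon> * s0" "s1 \<in> ?B" "alen \<gamma> = h 0 + \<epsilon> * s1"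
    using aff by (metis (no_types, lifting) imageE)
  have cases: "(\<epsilon> = 1 \<and> h 0 = 0 \<or> \<epsilon> = -1 \<and> h 0 = alen \<gamma>) \<and> alen \<eta> = alen \<gamma>"
    using eps
  proof
    assume "\<epsilon> = 1"
    then show ?thesis using ends s01 by simp
  next
    assume "\<epsilon> = -1"
    then show ?thesis using ends s01 by simp
  qed
  have ext: "amap \<gamma> \<in> extensional ?A" "amap \<eta> \<in> extensional ?B"
    using g e by (auto simp: regular_arc_def)
  from cases show ?thesis
  proof (elim conjE disjE)
    assume *: "alen \<eta> = alen \<gamma>" "\<epsilon> = 1" "h 0 = 0"
    have "amap \<eta> s = amap \<gamma> s" if "s \<in> ?B" for s
      using aff[OF that] gh[OF that] * by simp
    then have "amap \<eta> = amap \<gamma>"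
      using ext * by (intro extensionalityI[where A = ?A]) auto
    then show ?thesis using * by simp
  next
    assume *: "alen \<eta> = alen \<gamma>" "\<epsilon> = -1" "h 0 = alen \<gamma>"
    have "amap \<eta> s = amap \<gamma> (alen \<gamma> - s)" if "s \<in> ?B" for s
      using aff[OF that] gh[OF that] * by simp
    then have "amap \<eta> = restrict (\<lambda>t. amap \<gamma> (alen \<gamma> - t)) ?A"
      using ext * by (intro extensionalityI[where A = ?A]) auto
    then show ?thesis using * by (simp add: reverse_arc_def)
  qed
qed

text \<open>This identifies the arc selected by the definite description in the scheme at points that are not
  vertices.\<close>

lemma arc_through_nonvertex_unique:
  assumes "network E" "orientation E Ep" "y \<notin> net_vertices E"
    and "\<gamma> \<in> arcs_at Ep y" "\<eta> \<in> arcs_at Ep y"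
  shows "\<eta> = \<gamma>"
proof -
  have mem: "\<gamma> \<in> E" "\<eta> \<in> E" "\<gamma> \<in> Ep" "\<eta> \<in> Ep" "y \<in> support \<gamma> \<inter> support \<eta>"
    using assms by (auto simp: arcs_at_def orientation_def)
  then have "support \<gamma> = support \<eta>"
    using assms(1,3) unfolding network_def net_vertices_def by blast
  then have "\<eta> = \<gamma> \<or> \<eta> = reverse_arc \<gamma>"
    using mem assms(1) by (intro same_support_imp_eq_or_reverse) (auto simp: network_def)
  then show ?thesis
    using mem assms(2) by (auto simp: orientation_def)
qed

section \<open>Modified Hamiltonians and Lagrangians\<close>

text \<open>Since the envelope is a supremum of real numbers, it is meaningful only if \<open>f\<close> has a convex
  minorant, which the lemmas below call \<open>h0\<close>.\<close>

lemma convex_envelope_le: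
  assumes "convex_on UNIV h0" "\<And>\<nu>. h0 \<nu> \<le> f \<nu>"
  shows "convex_envelope f \<mu> \<le> f \<mu>"
  unfolding convex_envelope_def
  by (rule cSup_least) (use assms in auto)

lemma le_convex_envelope:
  assumes "convex_on UNIV h" "\<And>\<nu>. h \<nu> \<le> f \<nu>"
  shows "h \<mu> \<le> convex_envelope f \<mu>"
  unfolding convex_envelope_def
  by (rule cSup_upper) (use assms in \<open>auto intro: bdd_aboveI[of _ "f \<mu>"]\<close>)

lemma convex_on_convex_envelope:
  assumes "convex_on UNIV h0" "\<And>\<nu>. h0 \<nu> \<le> f \<nu>"
  shows "convex_on UNIV (convex_envelope f)"
proof (rule convex_onI)
  fix t x y :: real
  assume t: "0 < t" "t < 1"
  show "convex_envelope f ((1 - t) *\<^sub>R x + t *\<^sub>R y) \<le> (1 - t) * convex_envelope f x + t * convex_envelope f y"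
    unfolding convex_envelope_def[of f "(1 - t) *\<^sub>R x + t *\<^sub>R y"]
  proof (rule cSup_least)
    fix z assume "z \<in> {h ((1 - t) *\<^sub>R x + t *\<^sub>R y) |h. convex_on UNIV h \<and> (\<forall>\<nu>. h \<nu> \<le> f \<nu>)}"
    then obtain h where h: "z = h ((1 - t) *\<^sub>R x + t *\<^sub>R y)" "convex_on UNIV h" "\<And>\<nu>. h \<nu> \<le> f \<nu>" by auto
    have "z \<le> (1 - t) * h x + t * h y"
      unfolding h(1) using t by (intro convex_onD[OF h(2)]) auto
    also have "\<dots> \<le> (1 - t) * convex_envelope f x + t * convex_envelope f y"
      using t le_convex_envelope[OF h(2,3)] by (intro add_mono mult_left_mono) auto
    finally show "z \<le> (1 - t) * convex_envelope f x + t * convex_envelope f y" .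
  qed (use assms in auto)
qed simp

text \<open>Passing to the envelope does not increase the one-sided uniform distance between two functions.\<close>

lemma convex_envelope_add_le:
  assumes "convex_on UNIV h0" "\<And>\<nu>. h0 \<nu> \<le> f \<nu>" and "\<And>\<nu>. f \<nu> \<le> f' \<nu> + \<omega>"
  shows "convex_envelope f \<mu> \<le> convex_envelope f' \<mu> + \<omega>"
  unfolding convex_envelope_def[of f]
proof (rule cSup_least)
  fix z assume "z \<in> {h \<mu> |h. convex_on UNIV h \<and> (\<forall>\<nu>. h \<nu> \<le> f \<nu>)}"
  then obtain h where h: "z = h \<mu>" "convex_on UNIV h" "\<And>\<nu>. h \<nu> \<le> f \<nu>" by auto
  have "convex_on UNIV (\<lambda>\<nu>. h \<nu> + - \<omega>)"
    by (intro convex_on_add h convex_on_const[THEN iffD2] convex_UNIV)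
  moreover have "h \<nu> + - \<omega> \<le> f' \<nu>" for \<nu>
    using h(3)[of \<nu>] assms(3)[of \<nu>] by linarith
  ultimately have "h \<mu> + - \<omega> \<le> convex_envelope f' \<mu>"
    by (rule le_convex_envelope)
  then show "z \<le> convex_envelope f' \<mu> + \<omega>" using h(1) by simp
qed (use assms in auto)

locale modified_hamiltonian =
  fixes Ht :: "'a hamiltonian" and \<gamma> :: "'a net_arc" and \<beta>\<^sub>0 \<mu>b :: real
  assumes Ht_cont: "continuous_on ({0..alen \<gamma>} \<times> UNIV) (\<lambda>(s, \<mu>). Ht \<gamma> s \<mu>)"
    and \<beta>\<^sub>0_pos: "0 < \<beta>\<^sub>0" and \<mu>b_pos: "0 < \<mu>b"
    and below: "\<And>s \<mu>. s \<in> {0..alen \<gamma>} \<Longrightarrow> \<mu> < - \<mu>b \<Longrightarrow> Ht \<gamma> s \<mu> > Ht \<gamma> s (- \<mu>b) - \<beta>\<^sub>0 * (\<mu> + \<mu>b)"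
    and above: "\<And>s \<mu>. s \<in> {0..alen \<gamma>} \<Longrightarrow> \<mu> > \<mu>b \<Longrightarrow> Ht \<gamma> s \<mu> > Ht \<gamma> s \<mu>b + \<beta>\<^sub>0 * (\<mu> - \<mu>b)"
begin

abbreviation "H0 \<equiv> H_zero Ht \<beta>\<^sub>0 \<mu>b \<gamma>"
abbreviation "H \<equiv> H_mod Ht \<beta>\<^sub>0 \<mu>b \<gamma>"
abbreviation "L \<equiv> L_mod Ht \<beta>\<^sub>0 \<mu>b \<gamma>"

text \<open>The truncated Hamiltonian is the original one at the clamped momentum, plus a term that does not
  depend on \<open>s\<close>. Bounds and continuity in \<open>s\<close> that are uniform in \<open>\<mu>\<close> thus follow from compactness
  of \<open>[-\<mu>b, \<mu>b]\<close>.\<close>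

lemma H_zero_clamp:
  "H0 s \<mu> = Ht \<gamma> s (max (- \<mu>b) (min \<mu>b \<mu>)) + \<beta>\<^sub>0 * max 0 (\<bar>\<mu>\<bar> - \<mu>b)"
  using \<mu>b_pos by (cases "\<mu> < - \<mu>b"; cases "\<mu>b < \<mu>") (simp_all add: H_zero_def algebra_simps)

lemma H_zero_le: "s \<in> {0..alen \<gamma>} \<Longrightarrow> H0 s \<mu> \<le> Ht \<gamma> s \<mu>"
  using below[of s \<mu>] above[of s \<mu>] by (simp add: H_zero_def less_imp_le)

lemma H_zero_bounds:
  obtains m M where "\<And>s \<mu>. s \<in> {0..alen \<gamma>} \<Longrightarrow> m \<le> H0 s \<mu>"
    "\<And>s \<mu>. s \<in> {0..alen \<gamma>} \<Longrightarrow> H0 s \<mu> \<le> M + \<beta>\<^sub>0 * \<bar>\<mu>\<bar>"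
proof -
  let ?K = "{0..alen \<gamma>} \<times> {- \<mu>b..\<mu>b}"
  have "continuous_on ?K (\<lambda>(s, \<mu>). Ht \<gamma> s \<mu>)"
    by (rule continuous_on_subset[OF Ht_cont]) auto
  then have "bounded ((\<lambda>(s, \<mu>). Ht \<gamma> s \<mu>) ` ?K)"
    by (intro compact_imp_bounded compact_continuous_image compact_Times) auto
  then obtain B where B: "\<And>y. y \<in> (\<lambda>(s, \<mu>). Ht \<gamma> s \<mu>) ` ?K \<Longrightarrow> \<bar>y\<bar> \<le> B"
    unfolding bounded_iff real_norm_def by blast
  have bd: "\<bar>Ht \<gamma> s (max (- \<mu>b) (min \<mu>b \<mu>))\<bar> \<le> B" if "s \<in> {0..alen \<gamma>}" for s \<mu>
    using that \<mu>b_pos by (intro B) (force simp: image_iff)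
  have pos: "0 \<le> \<beta>\<^sub>0 * max 0 (\<bar>\<mu>\<bar> - \<mu>b)" "\<beta>\<^sub>0 * max 0 (\<bar>\<mu>\<bar> - \<mu>b) \<le> \<beta>\<^sub>0 * \<bar>\<mu>\<bar>" for \<mu>
    using \<beta>\<^sub>0_pos \<mu>b_pos by (auto intro!: mult_left_mono)
  show ?thesis
  proof (rule that[of "- B" B])
    fix s \<mu> assume s: "s \<in> {0..alen \<gamma>}"
    show "- B \<le> H0 s \<mu>" "H0 s \<mu> \<le> B + \<beta>\<^sub>0 * \<bar>\<mu>\<bar>"
      unfolding H_zero_clamp using bd[OF s, of \<mu>] pos[of \<mu>] by linarith+
  qed
qed

lemma H_zero_equicontinuous:
  assumes "\<sigma> \<in> {0..alen \<gamma>}" "0 < e"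
  obtains d where "0 < d"
    "\<And>s \<mu>. s \<in> {0..alen \<gamma>} \<Longrightarrow> \<bar>s - \<sigma>\<bar> < d \<Longrightarrow> H0 s \<mu> \<le> H0 \<sigma> \<mu> + e"
proof -
  let ?K = "{0..alen \<gamma>} \<times> {- \<mu>b..\<mu>b}"
  have "uniformly_continuous_on ?K (\<lambda>(s, \<mu>). Ht \<gamma> s \<mu>)"
    by (intro compact_uniformly_continuous continuous_on_subset[OF Ht_cont] compact_Times) auto
  from this[unfolded uniformly_continuous_on_def, rule_format, OF assms(2)]
  obtain d where d: "0 < d" "\<And>p q. p \<in> ?K \<Longrightarrow> q \<in> ?K \<Longrightarrow> dist q p < d \<Longrightarrow>
      dist ((\<lambda>(s, \<mu>). Ht \<gamma> s \<mu>) q) ((\<lambda>(s, \<mu>). Ht \<gamma> s \<mu>) p) < e"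
    by blast
  show ?thesis
  proof (rule that[OF d(1)])
    fix s \<mu> assume s: "s \<in> {0..alen \<gamma>}" "\<bar>s - \<sigma>\<bar> < d"
    let ?m = "max (- \<mu>b) (min \<mu>b \<mu>)"
    have "dist (s, ?m) (\<sigma>, ?m) < d"
      using s by (simp add: dist_Pair_Pair dist_real_def)
    then have "dist (Ht \<gamma> s ?m) (Ht \<gamma> \<sigma> ?m) < e"
      using d(2)[of "(\<sigma>, ?m)" "(s, ?m)"] s assms(1) \<mu>b_pos by auto
    then show "H0 s \<mu> \<le> H0 \<sigma> \<mu> + e"
      unfolding H_zero_clamp by (simp add: dist_real_def)
  qed
qed

lemma H_mod_bounds:
  obtains m M where "\<And>s \<mu>. s \<in> {0..alen \<gamma>} \<Longrightarrow> m \<le> H s \<mu>"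
    "\<And>s \<mu>. s \<in> {0..alen \<gamma>} \<Longrightarrow> H s \<mu> \<le> M + \<beta>\<^sub>0 * \<bar>\<mu>\<bar>"
proof -
  obtain m M where mM: "\<And>s \<mu>. s \<in> {0..alen \<gamma>} \<Longrightarrow> m \<le> H0 s \<mu>"
    "\<And>s \<mu>. s \<in> {0..alen \<gamma>} \<Longrightarrow> H0 s \<mu> \<le> M + \<beta>\<^sub>0 * \<bar>\<mu>\<bar>"
    by (rule H_zero_bounds) blast
  have cst: "convex_on UNIV (\<lambda>_::real. m)" by (simp add: convex_on_const)
  show ?thesis
  proof (rule that[of m M])
    fix s \<mu> assume s: "s \<in> {0..alen \<gamma>}"
    show "m \<le> H s \<mu>"
      unfolding H_mod_def by (rule le_convex_envelope[OF cst mM(1)[OF s]])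
    show "H s \<mu> \<le> M + \<beta>\<^sub>0 * \<bar>\<mu>\<bar>"
      unfolding H_mod_def
      using convex_envelope_le[where f = "H0 s" and \<mu> = \<mu>, OF cst mM(1)[OF s]] mM(2)[OF s, of \<mu>] by linarith
  qed
qed

lemma convex_minorant:
  assumes "s \<in> {0..alen \<gamma>}"
  obtains h where "convex_on UNIV h" "\<And>\<nu>. h \<nu> \<le> H0 s \<nu>"
proof -
  obtain m M where mM: "\<And>s \<mu>. s \<in> {0..alen \<gamma>} \<Longrightarrow> m \<le> H0 s \<mu>"
    by (rule H_zero_bounds) blast
  show ?thesis
    by (rule that[of "\<lambda>_. m"]) (use mM[OF assms] in \<open>simp_all add: convex_on_const\<close>)
qed

lemma H_mod_le: 
  assumes "s \<in> {0..alen \<gamma>}" 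
  shows "H s \<mu> \<le> Ht \<gamma> s \<mu>"
proof -
  obtain h where "convex_on UNIV h" "\<And>\<nu>. h \<nu> \<le> H0 s \<nu>"
    by (rule convex_minorant[OF assms]) blast
  from convex_envelope_le[OF this] show ?thesis
    using H_zero_le[OF assms] unfolding H_mod_def by (rule order_trans)
qed

lemma isCont_H_mod:
  assumes "s \<in> {0..alen \<gamma>}"
  shows "isCont (H s) \<mu>"
proof -
  obtain h where "convex_on UNIV h" "\<And>\<nu>. h \<nu> \<le> H0 s \<nu>"
    by (rule convex_minorant[OF assms]) blast
  then have "convex_on UNIV (H s)"
    unfolding H_mod_def by (rule convex_on_convex_envelope)
  then have "continuous_on UNIV (H s)"
    by (intro convex_on_continuous) auto
  then show ?thesis
    by (simp add: continuous_on_eq_continuous_at)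
qed

text \<open>A strict inequality for \<open>H \<sigma> \<mu>\<close> at fixed \<open>\<mu>\<close> persists for nearby \<open>s\<close>. The envelope inherits the
  modulus of continuity in \<open>s\<close> from the truncated Hamiltonian, because the latter is uniform in \<open>\<mu>\<close>.\<close>

lemma H_mod_upper_semicontinuous:
  assumes "\<sigma> \<in> {0..alen \<gamma>}" "H \<sigma> \<mu> < a"
  obtains d where "0 < d" "\<And>s. s \<in> {0..alen \<gamma>} \<Longrightarrow> \<bar>s - \<sigma>\<bar> < d \<Longrightarrow> H s \<mu> < a"
proof -
  let ?e = "(a - H \<sigma> \<mu>) / 2"
  obtain d where d: "0 < d"
    "\<And>s \<mu>. s \<in> {0..alen \<gamma>} \<Longrightarrow> \<bar>s - \<sigma>\<bar> < d \<Longrightarrow> H0 s \<mu> \<le> H0 \<sigma> \<mu> + ?e"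
    using H_zero_equicontinuous[OF assms(1), of ?e] assms(2) by auto
  show ?thesis
  proof (rule that[OF d(1)])
    fix s assume s: "s \<in> {0..alen \<gamma>}" "\<bar>s - \<sigma>\<bar> < d"
    obtain h where "convex_on UNIV h" "\<And>\<nu>. h \<nu> \<le> H0 s \<nu>"
      by (rule convex_minorant[OF s(1)]) blast
    from convex_envelope_add_le[OF this d(2)[OF s], of \<mu>]
    have "H s \<mu> \<le> H \<sigma> \<mu> + ?e" by (simp add: H_mod_def)
    then show "H s \<mu> < a" using assms(2) by (simp add: field_simps)
  qed
qed

lemma Fenchel_L_mod: "ereal (\<mu> * l - H s \<mu>) \<le> L s l"
  unfolding L_mod_def by (rule SUP_upper) simp

text \<open>The Hamiltonian grows at most with slope \<open>\<beta>\<^sub>0\<close>, so speeds above \<open>\<beta>\<^sub>0\<close> have infinite cost. One step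
  of the scheme therefore looks no further than \<open>\<beta>\<^sub>0 \<Delta>t\<close>, which keeps all arguments local.\<close>

lemma L_mod_eq_infinity:
  assumes s: "s \<in> {0..alen \<gamma>}" and l: "\<beta>\<^sub>0 < \<bar>l\<bar>"
  shows "L s l = \<infinity>"
proof -
  obtain m M where M: "\<And>s \<mu>. s \<in> {0..alen \<gamma>} \<Longrightarrow> H s \<mu> \<le> M + \<beta>\<^sub>0 * \<bar>\<mu>\<bar>"
    by (rule H_mod_bounds) blast
  have "ereal B \<le> L s l" for B
  proof -
    define r where "r = \<bar>B + M\<bar> / (\<bar>l\<bar> - \<beta>\<^sub>0)"
    have r: "0 \<le> r" "r * (\<bar>l\<bar> - \<beta>\<^sub>0) = \<bar>B + M\<bar>"
      using l by (simp_all add: r_def)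
    have "H s (sgn l * r) \<le> M + \<beta>\<^sub>0 * r"
      using M[OF s, of "sgn l * r"] r(1) l \<beta>\<^sub>0_pos by (simp add: abs_mult abs_sgn_eq of_bool_def split: if_splits)
    moreover have "sgn l * r * l = r * \<bar>l\<bar>"
      by (simp add: abs_sgn mult.commute)
    ultimately have "B \<le> sgn l * r * l - H s (sgn l * r)"
      using r(2) mult.commute[of r \<beta>\<^sub>0] unfolding right_diff_distrib by linarith
    then have "ereal B \<le> ereal (sgn l * r * l - H s (sgn l * r))" by simp
    also have "\<dots> \<le> L s l" by (rule Fenchel_L_mod)
    finally show ?thesis .
  qed
  then show ?thesis by (rule ereal_top)
qed

lemma L_mod_zero_finite:
  assumes "s \<in> {0..alen \<gamma>}"
  shows "L s 0 < \<infinity>"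
proof -
  obtain m M where m: "\<And>s \<mu>. s \<in> {0..alen \<gamma>} \<Longrightarrow> m \<le> H s \<mu>"
    by (rule H_mod_bounds) blast
  have "L s 0 \<le> ereal (- m)"
    unfolding L_mod_def by (rule SUP_least) (use m[OF assms] in simp)
  then show ?thesis by (rule order_le_less_trans) simp
qed

text \<open>A single \<open>e\<close> serves both as the radius and as the margin of strictness.\<close>

lemma strict_subsolution_slopes_near:
  assumes "\<sigma> \<in> {0..alen \<gamma>}" "finite F" "\<And>l m. (l, m) \<in> F \<Longrightarrow> H \<sigma> m + l < 0"
  obtains e where "0 < e"
    "\<And>s l m. s \<in> {0..alen \<gamma>} \<Longrightarrow> \<bar>s - \<sigma>\<bar> < e \<Longrightarrow> (l, m) \<in> F \<Longrightarrow> H s m + l \<le> - e"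
proof -
  have "\<forall>p\<in>F. \<forall>\<^sub>F e in at_right 0. \<forall>s\<in>{0..alen \<gamma>}. \<bar>s - \<sigma>\<bar> < e \<longrightarrow> H s (snd p) + fst p \<le> - e"
  proof
    fix p assume p: "p \<in> F"
    define l m where "l = fst p" and "m = snd p"
    define a where "a = - (H \<sigma> m + l) / 2"
    have a: "0 < a" "H \<sigma> m < - l - a" using assms(3)[of l m] p by (simp_all add: a_def l_def m_def field_simps)
    obtain d where d: "0 < d" "\<And>s. s \<in> {0..alen \<gamma>} \<Longrightarrow> \<bar>s - \<sigma>\<bar> < d \<Longrightarrow> H s m < - l - a"
      using H_mod_upper_semicontinuous[OF assms(1) a(2)] by blast
    have "\<forall>\<^sub>F e in at_right 0. e < min a d"
      using a(1) d(1) by (intro eventually_at_rightI[of 0 "min a d"]) auto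
    then show "\<forall>\<^sub>F e in at_right 0. \<forall>s\<in>{0..alen \<gamma>}. \<bar>s - \<sigma>\<bar> < e \<longrightarrow> H s (snd p) + fst p \<le> - e"
    proof eventually_elim
      case (elim e)
      show ?case
      proof (intro ballI impI)
        fix s assume "s \<in> {0..alen \<gamma>}" "\<bar>s - \<sigma>\<bar> < e"
        then show "H s (snd p) + fst p \<le> - e"
          using d(2)[of s] elim by (simp add: l_def m_def)
      qed
    qed
  qed
  then have "\<forall>\<^sub>F e in at_right (0::real). \<forall>p\<in>F. \<forall>s\<in>{0..alen \<gamma>}. \<bar>s - \<sigma>\<bar> < e \<longrightarrow> H s (snd p) + fst p \<le> - e"
    by (rule eventually_ball_finite[OF assms(2)])
  then obtain b where b: "0 < b"
    "\<And>e. 0 < e \<Longrightarrow> e < b \<Longrightarrow> \<forall>p\<in>F. \<forall>s\<in>{0..alen \<gamma>}. \<bar>s - \<sigma>\<bar> < e \<longrightarrow> H s (snd p) + fst p \<le> - e"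
    unfolding eventually_at_right_field by blast
  show ?thesis
    by (rule that[of "b / 2"]) (use b(1) b(2)[of "b / 2"] in fastforce)+
qed

end

section \<open>One step of the scheme\<close>

lemma num_cells_pos: "0 < dx \<Longrightarrow> 0 < alen \<gamma> \<Longrightarrow> 0 < num_cells \<gamma> dx"
  by (simp add: num_cells_def)

lemma node_mem: "0 < alen \<gamma> \<Longrightarrow> i \<le> num_cells \<gamma> dx \<Longrightarrow> node \<gamma> dx i \<in> {0..alen \<gamma>}"
  by (cases "num_cells \<gamma> dx = 0") (auto simp: node_def divide_simps)

text \<open>Linear interpolation is a convex combination of two nodal values, hence at least the smaller one.
  Bounds from below thus carry over from nodes to all points.\<close>

lemma interp_ge_node:
  assumes "0 < dx" "0 < alen \<gamma>" "y \<in> {0..alen \<gamma>}"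
  obtains i where "i \<le> num_cells \<gamma> dx" "\<bar>node \<gamma> dx i - y\<bar> \<le> dx"
    "w (node \<gamma> dx i, t) \<le> interp \<gamma> dx w y t"
proof -
  define N where "N = num_cells \<gamma> dx"
  define h where "h = alen \<gamma> / real N"
  define i where "i = min (N - 1) (nat \<lfloor>y / h\<rfloor>)"
  define \<theta> where "\<theta> = (y - node \<gamma> dx i) / h"
  have N: "0 < N" unfolding N_def by (rule num_cells_pos[OF assms(1,2)])
  then have h: "0 < h" using assms(2) by (simp add: h_def)
  have "alen \<gamma> / dx \<le> real N"
    unfolding N_def num_cells_def by (rule real_nat_ceiling_ge)
  then have hdx: "h \<le> dx" using assms(1) N by (simp add: h_def field_simps)
  have node: "node \<gamma> dx j = real j * h" for j
    by (simp add: node_def h_def N_def)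
  have q: "0 \<le> y / h" "y / h \<le> real N"
    using assms(2,3) h N by (simp_all add: h_def field_simps)
  have "real i \<le> real (nat \<lfloor>y / h\<rfloor>)" by (simp add: i_def)
  also have "\<dots> \<le> y / h" using q by simp
  finally have lo: "real i \<le> y / h" .
  have hi: "y / h \<le> real i + 1"
  proof (cases "nat \<lfloor>y / h\<rfloor> \<le> N - 1")
    case True
    then have "i = nat \<lfloor>y / h\<rfloor>" by (simp add: i_def)
    then show ?thesis using q by linarith
  next
    case False
    then have "real i + 1 = real N" using N by (simp add: i_def)
    then show ?thesis using q by simp
  qed
  have th: "\<theta> = y / h - real i" using h by (simp add: \<theta>_def node diff_divide_distrib)
  have th01: "0 \<le> \<theta>" "\<theta> \<le> 1" using lo hi th by auto
  have yi: "y - node \<gamma> dx i = \<theta> * h" "node \<gamma> dx (Suc i) - y = (1 - \<theta>) * h"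
    using h by (simp_all add: th node algebra_simps)
  have near: "\<bar>node \<gamma> dx i - y\<bar> \<le> dx" "\<bar>node \<gamma> dx (Suc i) - y\<bar> \<le> dx"
  proof -
    have "\<theta> * h \<le> h" "(1 - \<theta>) * h \<le> h" "0 \<le> \<theta> * h" "0 \<le> (1 - \<theta>) * h"
      using th01 h by (simp_all add: mult_left_le_one_le)
    then show "\<bar>node \<gamma> dx i - y\<bar> \<le> dx" "\<bar>node \<gamma> dx (Suc i) - y\<bar> \<le> dx"
      using yi hdx by linarith+
  qed
  have le: "i \<le> num_cells \<gamma> dx" "Suc i \<le> num_cells \<gamma> dx"
    using N by (auto simp: i_def N_def)
  let ?a = "w (node \<gamma> dx i, t)" and ?b = "w (node \<gamma> dx (Suc i), t)"
  have "interp \<gamma> dx w y t = ?a + \<theta> * (?b - ?a)"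
    by (simp add: interp_def Let_def \<theta>_def i_def h_def N_def)
  then have eq: "interp \<gamma> dx w y t = ?a + \<theta> * (?b - ?a)" "interp \<gamma> dx w y t = ?b + (1 - \<theta>) * (?a - ?b)"
    by (simp_all add: algebra_simps)
  show ?thesis
  proof (cases "?a \<le> ?b")
    case True
    then have "?a \<le> interp \<gamma> dx w y t" using th01 by (simp add: eq(1))
    then show ?thesis by (rule that[OF le(1) near(1)])
  next
    case False
    then have "?b \<le> interp \<gamma> dx w y t" using th01 by (simp add: eq(2))
    then show ?thesis by (rule that[OF le(2) near(2)])
  qed
qed

text \<open>The barrier: a minimum of affine functions, given by their pairs of time slope and space slope.
  Minima are used because the scheme is an infimum.\<close>

definition roof :: "(real \<times> real) set \<Rightarrow> real \<Rightarrow> real \<Rightarrow> real" where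
  "roof F \<theta> z = Min ((\<lambda>(l, m). l * \<theta> + m * z) ` F)"

lemma roof_le: "finite F \<Longrightarrow> (l, m) \<in> F \<Longrightarrow> roof F \<theta> z \<le> l * \<theta> + m * z"
  unfolding roof_def by (rule Min_le) (auto intro: rev_image_eqI)

lemma roof_attained:
  assumes "finite F" "F \<noteq> {}"
  obtains l m where "(l, m) \<in> F" "roof F \<theta> z = l * \<theta> + m * z"
proof -
  have "roof F \<theta> z \<in> (\<lambda>(l, m). l * \<theta> + m * z) ` F"
    unfolding roof_def using assms by (intro Min_in) auto
  then show ?thesis using that by auto
qed

text \<open>A roof of strict subsolutions below \<open>w\<close> is propagated by one step of the scheme. For a control
  \<open>\<alpha>\<close>, pick a node near the foot \<open>s - dt \<alpha>\<close> whose value is below the interpolated one, and the affine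
  piece \<open>(l, m)\<close> that is active at this node. By the Fenchel inequality
  \<open>L s \<alpha> \<ge> m \<alpha> - H s m \<ge> m \<alpha> + l + \<eta>\<close>, the running cost pays for the increment of this piece along the
  step. What is left is the gain \<open>\<eta> dt\<close> against \<open>K dx\<close> for the distance from the foot to the node, and
  \<open>K (dt - \<tau>)\<close> for the mismatch between the step \<open>dt\<close> in the cost and the actual step \<open>\<tau>\<close>.\<close>

lemma (in modified_hamiltonian) S_arc_gt_roof:
  assumes pos: "0 < dx" "0 < alen \<gamma>" "0 < dt"
    and s: "s \<in> {0..alen \<gamma>}" "\<bar>s - \<sigma>\<bar> + \<beta>\<^sub>0 * dt + dx \<le> R"
    and F: "finite F" "F \<noteq> {}"
      "\<And>l m. (l, m) \<in> F \<Longrightarrow> H s m + l \<le> - \<eta> \<and> \<bar>l\<bar> \<le> K \<and> \<bar>m\<bar> \<le> K"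
    and small: "K * dx + K * (dt - \<tau>) < \<eta> * dt" "\<tau> \<le> dt"
    and w: "\<And>i. i \<le> num_cells \<gamma> dx \<Longrightarrow> \<bar>node \<gamma> dx i - \<sigma>\<bar> \<le> R \<Longrightarrow>
      C + roof F \<theta> (node \<gamma> dx i - \<sigma>) \<le> w (node \<gamma> dx i, t)"
  shows "C + roof F (\<theta> + \<tau>) (s - \<sigma>) < S_arc (L_mod Ht \<beta>\<^sub>0 \<mu>b) dx dt \<gamma> w s t"
proof -
  define B where "B = C + roof F (\<theta> + \<tau>) (s - \<sigma>) + (\<eta> * dt - K * dx - K * (dt - \<tau>))"
  let ?V = "\<lambda>\<alpha>. ereal (interp \<gamma> dx w (s - dt * \<alpha>) t) + ereal dt * L s \<alpha>"
  let ?I = "INF \<alpha>\<in>{(s - alen \<gamma>) / dt..s / dt}. ?V \<alpha>"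
  have "ereal B \<le> ?I"
  proof (rule INF_greatest)
    fix \<alpha> assume "\<alpha> \<in> {(s - alen \<gamma>) / dt..s / dt}"
    then have y: "s - dt * \<alpha> \<in> {0..alen \<gamma>}"
      using pos(3) by (auto simp: field_simps)
    show "ereal B \<le> ?V \<alpha>"
    proof (cases "\<beta>\<^sub>0 < \<bar>\<alpha>\<bar>")
      case True
      then show ?thesis using L_mod_eq_infinity[OF s(1) True] pos(3) by simp
    next
      case False
      obtain i where i: "i \<le> num_cells \<gamma> dx" "\<bar>node \<gamma> dx i - (s - dt * \<alpha>)\<bar> \<le> dx"
        "w (node \<gamma> dx i, t) \<le> interp \<gamma> dx w (s - dt * \<alpha>) t"
        by (rule interp_ge_node[OF pos(1,2) y])
      have "\<bar>dt * \<alpha>\<bar> \<le> \<beta>\<^sub>0 * dt"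
        using False pos(3) by (simp add: abs_mult mult.commute)
      then have "\<bar>node \<gamma> dx i - \<sigma>\<bar> \<le> R" using i(2) s(2) by linarith
      from w[OF i(1) this] i(3)
      have 1: "C + roof F \<theta> (node \<gamma> dx i - \<sigma>) \<le> interp \<gamma> dx w (s - dt * \<alpha>) t" by simp
      obtain l m where lm: "(l, m) \<in> F" "roof F \<theta> (node \<gamma> dx i - \<sigma>) = l * \<theta> + m * (node \<gamma> dx i - \<sigma>)"
        by (rule roof_attained[OF F(1,2)])
      note Flm = F(3)[OF lm(1)]
      have 2: "m * (s - dt * \<alpha> - \<sigma>) - K * dx \<le> m * (node \<gamma> dx i - \<sigma>)"
      proof -
        have "\<bar>m * (node \<gamma> dx i - (s - dt * \<alpha>))\<bar> \<le> K * dx"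
          unfolding abs_mult using Flm i(2) by (intro mult_mono) auto
        then show ?thesis unfolding right_diff_distrib by linarith
      qed
      have 3: "dt * l + \<eta> * dt \<le> - (dt * H s m)"
      proof -
        have "dt * (H s m + l) \<le> dt * - \<eta>" using Flm pos(3) by (intro mult_left_mono) auto
        then show ?thesis by (simp add: algebra_simps)
      qed
      have 4: "- (K * (dt - \<tau>)) \<le> l * (dt - \<tau>)"
      proof -
        have "(- K) * (dt - \<tau>) \<le> l * (dt - \<tau>)"
          using Flm small(2) by (intro mult_right_mono) auto
        then show ?thesis by simp
      qed
      have 5: "roof F (\<theta> + \<tau>) (s - \<sigma>) \<le> l * (\<theta> + \<tau>) + m * (s - \<sigma>)"
        by (rule roof_le[OF F(1) lm(1)])
      have "B \<le> interp \<gamma> dx w (s - dt * \<alpha>) t + dt * (m * \<alpha> - H s m)"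
        unfolding B_def using 1 2 3 4 5 lm(2) by (simp add: algebra_simps)
      then have "ereal B \<le> ereal (interp \<gamma> dx w (s - dt * \<alpha>) t) + ereal dt * ereal (m * \<alpha> - H s m)"
        by simp
      also have "\<dots> \<le> ?V \<alpha>"
        using pos(3) Fenchel_L_mod by (intro add_left_mono ereal_mult_left_mono) auto
      finally show ?thesis .
    qed
  qed
  moreover have "?I < \<infinity>"
  proof -
    have "?I \<le> ?V 0"
      by (rule INF_lower) (use s pos in \<open>auto simp: field_simps\<close>)
    also have "\<dots> < \<infinity>"
      using L_mod_zero_finite[OF s(1)] pos(3) by (cases "L s 0") auto
    finally show ?thesis .
  qed
  ultimately have "B \<le> real_of_ereal ?I"
    by (cases ?I) auto
  moreover have "C + roof F (\<theta> + \<tau>) (s - \<sigma>) < B"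
    unfolding B_def using small(1) by simp
  ultimately show ?thesis
    unfolding S_arc_def by simp
qed

section \<open>Convergence at the grid points\<close>

lemma num_steps_pos: "0 < T \<Longrightarrow> 0 < dt \<Longrightarrow> 0 < num_steps T dt"
  by (simp add: num_steps_def)

lemma time_node_mem: "0 < T \<Longrightarrow> n \<le> num_steps T dt \<Longrightarrow> time_node T dt n \<in> {0..T}"
  by (cases "num_steps T dt = 0") (auto simp: time_node_def divide_simps)

text \<open>The time nodes are spaced by \<open>T / N\<^sub>T\<close>, whereas the update uses \<open>\<Delta>t\<close>; the two differ by
  \<open>O(\<Delta>t\<^sup>2)\<close>.\<close>

lemma time_step_bounds:
  assumes "0 < T" "0 < dt"
  shows "T / real (num_steps T dt) \<le> dt" "dt - T / real (num_steps T dt) \<le> dt * (dt / T)"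
proof -
  let ?N = "real (num_steps T dt)"
  have N: "0 < ?N" using num_steps_pos[OF assms] by simp
  have lo: "T / dt \<le> ?N" unfolding num_steps_def by (rule real_nat_ceiling_ge)
  then show "T / ?N \<le> dt" using assms N by (simp add: field_simps)
  have "?N \<le> T / dt + 1"
    unfolding num_steps_def using assms by (simp add: of_nat_nat)
  then have "dt * ?N \<le> T + dt" using assms by (simp add: field_simps)
  then have "dt \<le> (T + dt) / ?N" using N by (simp only: pos_le_divide_eq)
  then have "dt - T / ?N \<le> dt / ?N" by (simp add: add_divide_distrib)
  also have "\<dots> \<le> dt / (T / dt)" using lo assms N by (intro divide_left_mono mult_pos_pos divide_pos_pos) auto
  finally show "dt - T / ?N \<le> dt * (dt / T)" by simp
qed

lemma geo_dist_nonneg: "0 \<le> geo_dist E x y"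
  by (simp add: geo_dist_def)

lemma amap_in_net_points: "\<gamma> \<in> E \<Longrightarrow> s \<in> {0..alen \<gamma>} \<Longrightarrow> amap \<gamma> s \<in> net_points E"
  unfolding net_points_def support_def by blast

lemma lipschitz_along_arc:
  assumes "lipschitz_wrt (geo_time_dist E) (net_points E \<times> {0..T}) u" "\<gamma> \<in> E" "regular_arc \<gamma>"
  obtains K where "0 \<le> K"
    "\<And>a b s t. \<lbrakk>a \<in> {0..alen \<gamma>}; b \<in> {0..alen \<gamma>}; s \<in> {0..T}; t \<in> {0..T}\<rbrakk> \<Longrightarrow>
      \<bar>u (amap \<gamma> a, s) - u (amap \<gamma> b, t)\<bar> \<le> K * (\<bar>a - b\<bar> + \<bar>s - t\<bar>)"
proof -
  obtain K where K: "\<And>p q. p \<in> net_points E \<times> {0..T} \<Longrightarrow> q \<in> net_points E \<times> {0..T} \<Longrightarrow>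
      \<bar>u p - u q\<bar> \<le> K * geo_time_dist E p q"
    using assms(1) unfolding lipschitz_wrt_def by blast
  show ?thesis
  proof (rule that[of "\<bar>K\<bar>"])
    fix a b s t assume *: "a \<in> {0..alen \<gamma>}" "b \<in> {0..alen \<gamma>}" "s \<in> {0..T}" "t \<in> {0..T}"
    let ?d = "geo_time_dist E (amap \<gamma> a, s) (amap \<gamma> b, t)"
    have d: "0 \<le> ?d" "?d \<le> \<bar>a - b\<bar> + \<bar>s - t\<bar>"
      using geo_dist_arc_le[OF assms(2,3) *(1,2)] geo_dist_nonneg[of E "amap \<gamma> a" "amap \<gamma> b"]
      by (simp_all add: geo_time_dist_def)
    have "\<bar>u (amap \<gamma> a, s) - u (amap \<gamma> b, t)\<bar> \<le> K * ?d"
      using * assms(2) by (intro K) (auto simp: amap_in_net_points)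
    also have "\<dots> \<le> \<bar>K\<bar> * ?d" using d by (intro mult_right_mono) auto
    also have "\<dots> \<le> \<bar>K\<bar> * (\<bar>a - b\<bar> + \<bar>s - t\<bar>)" using d by (intro mult_left_mono) auto
    finally show "\<bar>u (amap \<gamma> a, s) - u (amap \<gamma> b, t)\<bar> \<le> \<bar>K\<bar> * (\<bar>a - b\<bar> + \<bar>s - t\<bar>)" .
  qed simp
qed

text \<open>Convergence along all convergent sequences of grid points is uniform, by compactness: bad nodes
  along a subsequence accumulate at some point. Since the hypothesis speaks of full sequences of grid
  points, the bad subsequence is completed by grid points that converge to the same limit.\<close>

lemma uniform_on_nodes:
  assumes "\<gamma> \<in> E" "\<gamma> \<in> Ep" "regular_arc \<gamma>" "0 < T"
    and lip: "lipschitz_wrt (geo_time_dist E) (net_points E \<times> {0..T}) u"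
    and conv: "converges_uniformly (geo_time_dist E) (\<lambda>m. grid Ep T (dx m) (dt m)) v
      (net_points E \<times> {0..T}) u"
    and "0 < e"
  shows "\<forall>\<^sub>F m in sequentially. \<forall>i\<le>num_cells \<gamma> (dx m). \<forall>n\<le>num_steps T (dt m).
    \<bar>v m (amap \<gamma> (node \<gamma> (dx m) i), time_node T (dt m) n)
     - u (amap \<gamma> (node \<gamma> (dx m) i), time_node T (dt m) n)\<bar> < e"
    (is "eventually ?P sequentially")
proof (rule ccontr)
  have alen: "0 < alen \<gamma>" using assms(3) by (simp add: regular_arc_def)
  assume "\<not> eventually ?P sequentially"
  then obtain q :: "nat \<Rightarrow> nat" where q: "strict_mono q" "\<And>j. \<not> ?P (q j)"
    using not_eventually_sequentiallyD by blast
  define err where "err m i n = \<bar>v m (amap \<gamma> (node \<gamma> (dx m) i), time_node T (dt m) n)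
     - u (amap \<gamma> (node \<gamma> (dx m) i), time_node T (dt m) n)\<bar>" for m i n
  have "\<exists>i n. i \<le> num_cells \<gamma> (dx (q j)) \<and> n \<le> num_steps T (dt (q j)) \<and> e \<le> err (q j) i n" for j
    using q(2)[of j] unfolding err_def[symmetric] not_all not_imp not_less by blast
  then obtain i n where in_le: "\<And>j. i j \<le> num_cells \<gamma> (dx (q j))" "\<And>j. n j \<le> num_steps T (dt (q j))"
    and bad: "\<And>j. e \<le> err (q j) (i j) (n j)"
    by metis
  define p where "p j = (node \<gamma> (dx (q j)) (i j), time_node T (dt (q j)) (n j))" for j
  have p_mem: "p j \<in> {0..alen \<gamma>} \<times> {0..T}" for j
    unfolding p_def using node_mem[OF alen in_le(1)] time_node_mem[OF assms(4) in_le(2)] by blast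
  have "seq_compact ({0..alen \<gamma>} \<times> {0..T})"
    by (intro compact_imp_seq_compact compact_Times) auto
  then obtain l r where l: "l \<in> {0..alen \<gamma>} \<times> {0..T}"
    and r: "strict_mono (r :: nat \<Rightarrow> nat)" "(p \<circ> r) \<longlonglongrightarrow> l"
    by (rule seq_compactE[where f = p]) (use p_mem in auto)
  define \<Phi> where "\<Phi> = (\<lambda>(s, t). (amap \<gamma> s, t :: real))"
  have y: "\<Phi> l \<in> net_points E \<times> {0..T}"
    using l amap_in_net_points[OF assms(1)] by (auto simp: \<Phi>_def)
  define Q where "Q = q \<circ> r"
  have Q: "strict_mono Q" using q(1) r(1) by (simp add: Q_def strict_mono_o)
  obtain zs where zs: "\<And>m. zs m \<in> grid Ep T (dx m) (dt m)"
      "(\<lambda>m. geo_time_dist E (zs m) (\<Phi> l)) \<longlonglongrightarrow> 0"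
    using bspec[OF conv[unfolded converges_uniformly_def sets_converge_def, THEN conjunct1] y] by blast
  define ys where "ys m = (if m \<in> range Q then \<Phi> (p (r (inv Q m))) else zs m)" for m
  have ysQ: "ys (Q j) = \<Phi> (p (r j))" for j
    using Q by (simp add: ys_def strict_mono_imp_inj_on)
  have pl: "(\<lambda>j. \<bar>fst (p (r j)) - fst l\<bar> + \<bar>snd (p (r j)) - snd l\<bar>) \<longlonglongrightarrow> 0"
  proof -
    have "(\<lambda>j. \<bar>fst (p (r j)) - fst l\<bar> + \<bar>snd (p (r j)) - snd l\<bar>) \<longlonglongrightarrow> \<bar>fst l - fst l\<bar> + \<bar>snd l - snd l\<bar>"
      using r(2) unfolding o_def by (intro tendsto_intros)
    then show ?thesis by simp
  qed
  have grid_mem: "ys m \<in> grid Ep T (dx m) (dt m)" for m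
  proof (cases "m \<in> range Q")
    case True
    then obtain j where j: "m = Q j" by blast
    have "i (r j) \<in> {0..num_cells \<gamma> (dx m)}" "n (r j) \<in> {0..num_steps T (dt m)}"
      using in_le[of "r j"] by (simp_all add: j Q_def)
    moreover have "ys m = (amap \<gamma> (node \<gamma> (dx m) (i (r j))), time_node T (dt m) (n (r j)))"
      using ysQ[of j] by (simp add: j \<Phi>_def p_def Q_def)
    ultimately show ?thesis
      unfolding grid_def space_grid_def by (simp only:) (intro SigmaI UN_I[OF assms(2)] imageI)
  qed (use zs(1) in \<open>simp add: ys_def\<close>)
  have "(\<lambda>m. geo_time_dist E (ys m) (\<Phi> l)) \<longlonglongrightarrow> 0"
  proof (rule LIMSEQ_I)
    fix \<epsilon> :: real assume "0 < \<epsilon>"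
    obtain M where M: "\<And>m. M \<le> m \<Longrightarrow> norm (geo_time_dist E (zs m) (\<Phi> l) - 0) < \<epsilon>"
      using LIMSEQ_D[OF zs(2) \<open>0 < \<epsilon>\<close>] by blast
    obtain J where J: "\<And>j. J \<le> j \<Longrightarrow>
        norm (\<bar>fst (p (r j)) - fst l\<bar> + \<bar>snd (p (r j)) - snd l\<bar> - 0) < \<epsilon>"
      using LIMSEQ_D[OF pl \<open>0 < \<epsilon>\<close>] by blast
    have "norm (geo_time_dist E (ys m) (\<Phi> l) - 0) < \<epsilon>" if m: "max M (Q J) \<le> m" for m
    proof (cases "m \<in> range Q")
      case True
      then obtain j where j: "m = Q j" by blast
      then have "J \<le> j" using m strict_mono_less_eq[OF Q] by simp
      from J[OF this] have small: "\<bar>fst (p (r j)) - fst l\<bar> + \<bar>snd (p (r j)) - snd l\<bar> < \<epsilon>"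
        by simp
      have "geo_dist E (amap \<gamma> (fst (p (r j)))) (amap \<gamma> (fst l)) \<le> \<bar>fst (p (r j)) - fst l\<bar>"
        using p_mem[of "r j"] l by (intro geo_dist_arc_le[OF assms(1,3)]) auto
      then show ?thesis
        using small geo_dist_nonneg[of E "amap \<gamma> (fst (p (r j)))" "amap \<gamma> (fst l)"]
        by (simp add: j ysQ \<Phi>_def geo_time_dist_def case_prod_beta)
    next
      case False
      then show ?thesis using M[of m] m by (simp add: ys_def)
    qed
    then show "\<exists>M. \<forall>m\<ge>M. norm (geo_time_dist E (ys m) (\<Phi> l) - 0) < \<epsilon>" by blast
  qed
  then have "(\<lambda>m. v m (ys m)) \<longlonglongrightarrow> u (\<Phi> l)"
    using conv[unfolded converges_uniformly_def, THEN conjunct2, rule_format, OF y] grid_mem by blast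
  from LIMSEQ_subseq_LIMSEQ[OF this Q]
  have 1: "(\<lambda>j. v (Q j) (\<Phi> (p (r j)))) \<longlonglongrightarrow> u (\<Phi> l)" by (simp add: o_def ysQ)
  obtain K where K: "0 \<le> K"
    "\<And>a b s t. \<lbrakk>a \<in> {0..alen \<gamma>}; b \<in> {0..alen \<gamma>}; s \<in> {0..T}; t \<in> {0..T}\<rbrakk> \<Longrightarrow>
      \<bar>u (amap \<gamma> a, s) - u (amap \<gamma> b, t)\<bar> \<le> K * (\<bar>a - b\<bar> + \<bar>s - t\<bar>)"
    using lipschitz_along_arc[OF lip assms(1,3)] by blast
  have "(\<lambda>j. u (\<Phi> (p (r j))) - u (\<Phi> l)) \<longlonglongrightarrow> 0"
  proof (rule Lim_null_comparison)
    show "\<forall>\<^sub>F j in sequentially. norm (u (\<Phi> (p (r j))) - u (\<Phi> l))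
        \<le> K * (\<bar>fst (p (r j)) - fst l\<bar> + \<bar>snd (p (r j)) - snd l\<bar>)"
    proof (rule always_eventually, rule allI)
      fix j
      show "norm (u (\<Phi> (p (r j))) - u (\<Phi> l))
        \<le> K * (\<bar>fst (p (r j)) - fst l\<bar> + \<bar>snd (p (r j)) - snd l\<bar>)"
        using K(2)[of "fst (p (r j))" "fst l" "snd (p (r j))" "snd l"] p_mem[of "r j"] l
        by (auto simp: \<Phi>_def)
    qed
    show "(\<lambda>j. K * (\<bar>fst (p (r j)) - fst l\<bar> + \<bar>snd (p (r j)) - snd l\<bar>)) \<longlonglongrightarrow> 0"
      using tendsto_mult_left[OF pl, of K] by simp
  qed
  from tendsto_diff[OF 1 Lim_transform[OF tendsto_const this]]
  have "(\<lambda>j. v (Q j) (\<Phi> (p (r j))) - u (\<Phi> (p (r j)))) \<longlonglongrightarrow> 0" by simp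
  from LIMSEQ_D[OF this assms(7)] obtain j where
    "norm (v (Q j) (\<Phi> (p (r j))) - u (\<Phi> (p (r j))) - 0) < e" by blast
  then show False
    using bad[of "r j"] by (simp add: \<Phi>_def p_def Q_def err_def)
qed

section \<open>Test functions\<close>

lemma C1_subtangent_has_derivative:
  assumes "C1_subtangent C w p \<phi>"
  obtains f' where "(\<phi> has_derivative f') (at p)"
  using assms unfolding C1_subtangent_def C1_on_def by blast

lemma C1_subtangent_expansion:
  assumes "C1_subtangent C w p \<phi>" "(\<phi> has_derivative f') (at p)" "0 < e"
  obtains d where "0 < d"
    "\<And>q. q \<in> C \<Longrightarrow> norm (q - p) < d \<Longrightarrow> w p + f' (q - p) - e * norm (q - p) \<le> w q"
proof -
  obtain U where U: "open U" "p \<in> U" "\<And>q. q \<in> C \<inter> U \<Longrightarrow> w p - \<phi> p \<le> w q - \<phi> q"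
    using assms(1) unfolding C1_subtangent_def by blast
  obtain d1 where d1: "0 < d1" "ball p d1 \<subseteq> U" using U(1,2) openE by blast
  obtain d2 where d2: "0 < d2"
    "\<And>q. norm (q - p) < d2 \<Longrightarrow> norm (\<phi> q - \<phi> p - f' (q - p)) \<le> e * norm (q - p)"
    using assms(2,3) unfolding has_derivative_at_alt by blast
  show ?thesis
  proof (rule that[of "min d1 d2"])
    fix q assume q: "q \<in> C" "norm (q - p) < min d1 d2"
    then have "q \<in> ball p d1" by (simp add: dist_norm norm_minus_commute)
    then have "w p - \<phi> p \<le> w q - \<phi> q" using U(3) d1(2) q(1) by blast
    then show "w p + f' (q - p) - e * norm (q - p) \<le> w q"
      using d2(2)[of q] q(2) by (simp add: abs_le_iff)
  qed (use d1 d2 in simp)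
qed

lemma C1_subtangent_real_expansion:
  fixes w :: "real \<Rightarrow> real"
  assumes "C1_subtangent C w p \<phi>" "0 < e"
  obtains d where "0 < d"
    "\<And>q. q \<in> C \<Longrightarrow> \<bar>q - p\<bar> < d \<Longrightarrow> w p + deriv \<phi> p * (q - p) - e * \<bar>q - p\<bar> \<le> w q"
proof -
  obtain f' where f': "(\<phi> has_derivative f') (at p)"
    by (rule C1_subtangent_has_derivative[OF assms(1)])
  then have bl: "bounded_linear f'" by (rule has_derivative_bounded_linear)
  have lin: "f' h = f' 1 * h" for h
    using linear_scale[OF bounded_linear.linear[OF bl], of h 1] by simp
  then have "f' = (*) (f' 1)" by (rule ext)
  then have "(\<phi> has_real_derivative f' 1) (at p)"
    using f' by (simp add: has_field_derivative_def)
  then have "deriv \<phi> p = f' 1" by (rule DERIV_imp_deriv)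
  moreover obtain d where d: "0 < d"
    "\<And>q. q \<in> C \<Longrightarrow> norm (q - p) < d \<Longrightarrow> w p + f' (q - p) - e * norm (q - p) \<le> w q"
    using C1_subtangent_expansion[OF assms(1) f' assms(2)] by blast
  ultimately show ?thesis
    using d(2)[unfolded lin[of "_ - p"]] by (intro that[OF d(1)]) simp
qed

lemma C1_subtangent_plane_expansion:
  fixes w :: "real \<times> real \<Rightarrow> real"
  assumes "C1_subtangent C w (\<sigma>, t0) \<phi>" "0 < e"
  obtains d where "0 < d"
    "\<And>s t. (s, t) \<in> C \<Longrightarrow> \<bar>s - \<sigma>\<bar> < d \<Longrightarrow> \<bar>t - t0\<bar> < d \<Longrightarrow>
      w (\<sigma>, t0) + deriv (\<lambda>t. \<phi> (\<sigma>, t)) t0 * (t - t0) + deriv (\<lambda>s. \<phi> (s, t0)) \<sigma> * (s - \<sigma>)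
        - e * (\<bar>s - \<sigma>\<bar> + \<bar>t - t0\<bar>) \<le> w (s, t)"
proof -
  obtain f' where f': "(\<phi> has_derivative f') (at (\<sigma>, t0))"
    by (rule C1_subtangent_has_derivative[OF assms(1)])
  interpret f': bounded_linear f' using f' by (rule has_derivative_bounded_linear)
  have split: "f' (a, b) = f' (1, 0) * a + f' (0, 1) * b" for a b
  proof -
    have "f' (a, b) = f' (a *\<^sub>R (1, 0) + b *\<^sub>R (0, 1))" by simp
    also have "\<dots> = a *\<^sub>R f' (1, 0) + b *\<^sub>R f' (0, 1)"
      by (simp only: f'.add linear_scale[OF f'.linear])
    finally show ?thesis by (simp add: mult.commute)
  qed
  have lin: "(\<lambda>h. f' (0, h)) = (*) (f' (0, 1))" "(\<lambda>h. f' (h, 0)) = (*) (f' (1, 0))"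
    by (rule ext, subst split, simp)+
  have "((\<lambda>t. \<phi> (\<sigma>, t)) has_derivative (\<lambda>h. f' (0, h))) (at t0)"
    by (rule has_derivative_compose[where g = \<phi> and f = "\<lambda>t. (\<sigma>, t)", OF _ f'])
       (auto intro!: derivative_eq_intros)
  then have "((\<lambda>t. \<phi> (\<sigma>, t)) has_real_derivative f' (0, 1)) (at t0)"
    unfolding has_field_derivative_def lin .
  then have dt: "deriv (\<lambda>t. \<phi> (\<sigma>, t)) t0 = f' (0, 1)" by (rule DERIV_imp_deriv)
  have "((\<lambda>s. \<phi> (s, t0)) has_derivative (\<lambda>h. f' (h, 0))) (at \<sigma>)"
    by (rule has_derivative_compose[where g = \<phi> and f = "\<lambda>s. (s, t0)", OF _ f'])
       (auto intro!: derivative_eq_intros)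
  then have "((\<lambda>s. \<phi> (s, t0)) has_real_derivative f' (1, 0)) (at \<sigma>)"
    unfolding has_field_derivative_def lin .
  then have ds: "deriv (\<lambda>s. \<phi> (s, t0)) \<sigma> = f' (1, 0)" by (rule DERIV_imp_deriv)
  obtain d where d: "0 < d" "\<And>q. q \<in> C \<Longrightarrow> norm (q - (\<sigma>, t0)) < d \<Longrightarrow>
      w (\<sigma>, t0) + f' (q - (\<sigma>, t0)) - e * norm (q - (\<sigma>, t0)) \<le> w q"
    using C1_subtangent_expansion[OF assms(1) f' assms(2)] by blast
  show ?thesis
  proof (rule that[of "d / 2"])
    fix s t assume *: "(s, t) \<in> C" "\<bar>s - \<sigma>\<bar> < d / 2" "\<bar>t - t0\<bar> < d / 2"
    have n: "norm (s - \<sigma>, t - t0) \<le> \<bar>s - \<sigma>\<bar> + \<bar>t - t0\<bar>"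
      using norm_Pair_le[of "s - \<sigma>" "t - t0"] by simp
    then have "w (\<sigma>, t0) + f' (s - \<sigma>, t - t0) - e * norm (s - \<sigma>, t - t0) \<le> w (s, t)"
      using d(2)[of "(s, t)"] * by simp
    moreover have "e * norm (s - \<sigma>, t - t0) \<le> e * (\<bar>s - \<sigma>\<bar> + \<bar>t - t0\<bar>)"
      using n assms(2) by simp
    ultimately show "w (\<sigma>, t0) + deriv (\<lambda>t. \<phi> (\<sigma>, t)) t0 * (t - t0)
        + deriv (\<lambda>s. \<phi> (s, t0)) \<sigma> * (s - \<sigma>) - e * (\<bar>s - \<sigma>\<bar> + \<bar>t - t0\<bar>) \<le> w (s, t)"
      unfolding dt ds using split[of "s - \<sigma>" "t - t0"] by linarith
  qed (use d in simp)
qed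

section \<open>Convergent discrete solutions near a vertex\<close>

text \<open>The setting of the theorem after passing to the convergent subsequence, with only those properties
  of the modified Hamiltonians that \<open>modified_hamiltonian\<close> collects.\<close>

locale convergent_scheme =
  fixes E Ep :: "'a::euclidean_space net_arc set"
    and Ht :: "'a hamiltonian"
    and c g :: "'a \<Rightarrow> real"
    and T \<beta>\<^sub>0 \<mu>b :: real
    and dx dt :: "nat \<Rightarrow> real"
    and v :: "nat \<Rightarrow> 'a \<times> real \<Rightarrow> real"
    and u :: "'a \<times> real \<Rightarrow> real"
  assumes net: "network E" and orient: "orientation E Ep"
    and flux: "flux_limiter E Ep Ht c"
    and T_pos: "0 < T"
    and modified: "\<And>\<gamma>. \<gamma> \<in> E \<Longrightarrow> modified_hamiltonian Ht \<gamma> \<beta>\<^sub>0 \<mu>b"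
    and adm: "\<And>m. admissible Ep T (dx m) (dt m)"
    and dt_lim: "dt \<longlonglongrightarrow> 0" and dx_lim: "dx \<longlonglongrightarrow> 0"
    and ratio_lim: "(\<lambda>m. dx m / dt m) \<longlonglongrightarrow> 0"
    and solution: "\<And>m. discrete_solution E Ep c (L_mod Ht \<beta>\<^sub>0 \<mu>b) g T (dx m) (dt m) (v m)"
    and u_lip: "lipschitz_wrt (geo_time_dist E) (net_points E \<times> {0..T}) u"
    and conv: "converges_uniformly (geo_time_dist E) (\<lambda>m. grid Ep T (dx m) (dt m)) v
      (net_points E \<times> {0..T}) u"
begin

abbreviation "L \<equiv> L_mod Ht \<beta>\<^sub>0 \<mu>b"
abbreviation "H \<equiv> H_mod Ht \<beta>\<^sub>0 \<mu>b"
abbreviation "nd \<gamma> m \<equiv> node \<gamma> (dx m)"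
abbreviation "tn m \<equiv> time_node T (dt m)"
abbreviation "NC \<gamma> m \<equiv> num_cells \<gamma> (dx m)"
abbreviation "NT m \<equiv> num_steps T (dt m)"
abbreviation "\<tau> m \<equiv> T / real (NT m)"

lemma dx_pos: "0 < dx m" and dt_pos: "0 < dt m"
  using adm[of m] by (simp_all add: admissible_def)

lemma oriented_arc: "\<gamma> \<in> Ep \<Longrightarrow> \<gamma> \<in> E" "\<gamma> \<in> Ep \<Longrightarrow> regular_arc \<gamma>" "\<gamma> \<in> Ep \<Longrightarrow> 0 < alen \<gamma>"
  using net orient by (auto simp: network_def orientation_def regular_arc_def)

lemma finite_arcs: "finite E" "finite Ep" "finite (net_vertices E)"
proof -
  show "finite E" using net by (simp add: network_def)
  then show "finite Ep" using orient by (auto simp: orientation_def intro: finite_subset)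
  show "finite (net_vertices E)"
    unfolding net_vertices_def end_points_def using \<open>finite E\<close> by auto
qed

lemma arcs_atD:
  assumes "\<gamma> \<in> arcs_at Ep x"
  shows "\<gamma> \<in> Ep" "arc_inv \<gamma> x \<in> {0..alen \<gamma>}" "amap \<gamma> (arc_inv \<gamma> x) = x"
proof -
  show \<gamma>: "\<gamma> \<in> Ep" using assms by (simp add: arcs_at_def)
  have x: "x \<in> amap \<gamma> ` {0..alen \<gamma>}" using assms by (simp add: arcs_at_def support_def)
  have inj: "inj_on (amap \<gamma>) {0..alen \<gamma>}" using oriented_arc(2)[OF \<gamma>] by (simp add: regular_arc_def)
  show "arc_inv \<gamma> x \<in> {0..alen \<gamma>}" "amap \<gamma> (arc_inv \<gamma> x) = x"
    unfolding arc_inv_def by (rule the_inv_into_into[OF inj x subset_refl], rule f_the_inv_into_f[OF inj x])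
qed

lemma arc_inv_amap:
  assumes "\<gamma> \<in> Ep" "s \<in> {0..alen \<gamma>}"
  shows "arc_inv \<gamma> (amap \<gamma> s) = s"
  using oriented_arc(2)[OF assms(1)] assms(2) unfolding arc_inv_def regular_arc_def
  by (intro the_inv_into_f_f) auto

lemma tn_Suc: "tn m (Suc n) = tn m n + \<tau> m"
  by (simp add: time_node_def algebra_simps add_divide_distrib)

lemma tn_0: "tn m 0 = 0"
  by (simp add: time_node_def)

lemma tau: "0 < \<tau> m" "\<tau> m \<le> dt m" "dt m - \<tau> m \<le> dt m * (dt m / T)"
  using time_step_bounds[OF T_pos dt_pos] num_steps_pos[OF T_pos dt_pos] T_pos by simp_all

lemma tn_less: "n < k \<Longrightarrow> tn m n < tn m k"
  using num_steps_pos[OF T_pos dt_pos, of m] T_pos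
  by (simp add: time_node_def divide_strict_right_mono)

text \<open>This is where \<open>\<Delta>x / \<Delta>t \<rightarrow> 0\<close> enters: the errors of one step are negligible with respect to \<open>\<Delta>t\<close>.\<close>

lemma ev_mesh_error:
  assumes "0 < \<eta>"
  shows "\<forall>\<^sub>F m in sequentially. K * dx m + K * (dt m - \<tau> m) < \<eta> * dt m"
proof -
  have "(\<lambda>m. \<bar>K\<bar> * (dx m / dt m) + \<bar>K\<bar> * (dt m / T)) \<longlonglongrightarrow> \<bar>K\<bar> * 0 + \<bar>K\<bar> * (0 / T)"
    using T_pos by (intro tendsto_intros ratio_lim dt_lim) auto
  then have "\<forall>\<^sub>F m in sequentially. \<bar>K\<bar> * (dx m / dt m) + \<bar>K\<bar> * (dt m / T) < \<eta>"
    using assms by (intro order_tendstoD(2)) auto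
  then show ?thesis
  proof eventually_elim
    case (elim m)
    have "K * dx m + K * (dt m - \<tau> m) \<le> \<bar>K\<bar> * dx m + \<bar>K\<bar> * (dt m * (dt m / T))"
      using tau[of m] dx_pos[of m] by (intro add_mono mult_mono) auto
    also have "\<dots> = (\<bar>K\<bar> * (dx m / dt m) + \<bar>K\<bar> * (dt m / T)) * dt m"
      using dt_pos[of m] by (simp add: field_simps)
    also have "\<dots> < \<eta> * dt m" using elim dt_pos[of m] by simp
    finally show ?case .
  qed
qed

lemma ev_le_const: "0 < e \<Longrightarrow> \<forall>\<^sub>F m in sequentially. a * dt m + b * dx m < e"
proof -
  assume "0 < e"
  have "(\<lambda>m. a * dt m + b * dx m) \<longlonglongrightarrow> a * 0 + b * 0"
    by (intro tendsto_intros dt_lim dx_lim)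
  then show ?thesis using \<open>0 < e\<close> by (intro order_tendstoD(2)) auto
qed

lemma vertex_is_node:
  assumes "x \<in> net_vertices E"
  obtains \<gamma> where "\<gamma> \<in> Ep" "\<And>m. \<exists>i\<le>NC \<gamma> m. amap \<gamma> (nd \<gamma> m i) = x"
proof -
  obtain \<eta> where \<eta>: "\<eta> \<in> E" "x \<in> end_points \<eta>" using assms by (auto simp: net_vertices_def)
  have "reverse_arc \<eta> \<in> E" "regular_arc \<eta>" using net \<eta>(1) by (auto simp: network_def)
  then have "end_points (reverse_arc \<eta>) = end_points \<eta>"
    by (auto simp: end_points_def reverse_arc_def regular_arc_def)
  moreover have "\<eta> \<in> Ep \<or> reverse_arc \<eta> \<in> Ep"
    using \<eta>(1) orient by (auto simp: orientation_def)
  ultimately obtain \<gamma> where \<gamma>: "\<gamma> \<in> Ep" "x \<in> end_points \<gamma>"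
    using \<eta>(2) by blast
  have "\<exists>i\<le>NC \<gamma> m. amap \<gamma> (nd \<gamma> m i) = x" for m
  proof -
    have "amap \<gamma> (nd \<gamma> m 0) = amap \<gamma> 0" "amap \<gamma> (nd \<gamma> m (NC \<gamma> m)) = amap \<gamma> (alen \<gamma>)"
      using num_cells_pos[OF dx_pos oriented_arc(3)[OF \<gamma>(1)]] by (simp_all add: node_def)
    then show ?thesis using \<gamma>(2) by (metis end_points_def insertE le0 le_refl singletonD)
  qed
  then show ?thesis using \<gamma>(1) that by blast
qed

lemma node_in_space_grid:
  "\<gamma> \<in> Ep \<Longrightarrow> i \<le> NC \<gamma> m \<Longrightarrow> amap \<gamma> (nd \<gamma> m i) \<in> space_grid Ep (dx m)"
  unfolding space_grid_def by (intro UN_I imageI) auto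

lemma scheme_step:
  assumes "x \<in> space_grid Ep (dx m)" "Suc n \<le> NT m"
  shows "v m (x, tn m (Suc n)) = S_net E Ep c L (dx m) (dt m) (v m) x (tn m n)"
  using solution[of m] assms unfolding discrete_solution_def by force

lemma scheme_step_interior:
  assumes "\<gamma> \<in> Ep" "i \<le> NC \<gamma> m" "amap \<gamma> (nd \<gamma> m i) \<notin> net_vertices E" "Suc n \<le> NT m"
  shows "v m (amap \<gamma> (nd \<gamma> m i), tn m (Suc n))
    = S_arc L (dx m) (dt m) \<gamma> (pullback (v m) \<gamma>) (nd \<gamma> m i) (tn m n)"
proof -
  let ?y = "amap \<gamma> (nd \<gamma> m i)"
  have mem: "nd \<gamma> m i \<in> {0..alen \<gamma>}" by (rule node_mem[OF oriented_arc(3)[OF assms(1)] assms(2)])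
  have \<gamma>y: "\<gamma> \<in> arcs_at Ep ?y" using assms(1) mem by (auto simp: arcs_at_def support_def)
  have "(THE \<gamma>. \<gamma> \<in> arcs_at Ep ?y) = \<gamma>"
    using \<gamma>y arc_through_nonvertex_unique[OF net orient assms(3) \<gamma>y] by (intro the_equality) auto
  then show ?thesis
    using scheme_step[OF node_in_space_grid[OF assms(1,2)] assms(4)] assms(3)
    by (simp add: S_net_def Let_def arc_inv_amap[OF assms(1) mem])
qed

lemma ev_close:
  assumes "\<gamma> \<in> Ep" "0 < e"
  shows "\<forall>\<^sub>F m in sequentially. \<forall>i\<le>NC \<gamma> m. \<forall>n\<le>NT m.
    \<bar>v m (amap \<gamma> (nd \<gamma> m i), tn m n) - u (amap \<gamma> (nd \<gamma> m i), tn m n)\<bar> < e"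
  using uniform_on_nodes[OF oriented_arc(1)[OF assms(1)] assms(1) oriented_arc(2)[OF assms(1)] T_pos
      u_lip conv assms(2)] .

lemma ev_close_vertex:
  assumes "x \<in> net_vertices E" "0 < e"
  shows "\<forall>\<^sub>F m in sequentially. \<forall>n\<le>NT m. \<bar>v m (x, tn m n) - u (x, tn m n)\<bar> < e"
proof -
  obtain \<gamma> where \<gamma>: "\<gamma> \<in> Ep" "\<And>m. \<exists>i\<le>NC \<gamma> m. amap \<gamma> (nd \<gamma> m i) = x"
    using vertex_is_node[OF assms(1)] by blast
  from ev_close[OF \<gamma>(1) assms(2)] show ?thesis
    by (rule eventually_mono) (use \<gamma>(2) in metis)
qed

lemma u_lip_vertex:
  assumes "x \<in> net_vertices E"
  obtains K where "0 \<le> K" "\<And>s t. s \<in> {0..T} \<Longrightarrow> t \<in> {0..T} \<Longrightarrow> \<bar>u (x, s) - u (x, t)\<bar> \<le> K * \<bar>s - t\<bar>"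
proof -
  obtain \<gamma> where \<gamma>: "\<gamma> \<in> Ep" "\<exists>i\<le>NC \<gamma> 0. amap \<gamma> (nd \<gamma> 0 i) = x"
    using vertex_is_node[OF assms] by metis
  then obtain a where a: "a \<in> {0..alen \<gamma>}" "amap \<gamma> a = x"
    using node_mem[OF oriented_arc(3)[OF \<gamma>(1)]] by blast
  obtain K where K: "0 \<le> K"
    "\<And>a b s t. \<lbrakk>a \<in> {0..alen \<gamma>}; b \<in> {0..alen \<gamma>}; s \<in> {0..T}; t \<in> {0..T}\<rbrakk> \<Longrightarrow>
      \<bar>u (amap \<gamma> a, s) - u (amap \<gamma> b, t)\<bar> \<le> K * (\<bar>a - b\<bar> + \<bar>s - t\<bar>)"
    using lipschitz_along_arc[OF u_lip oriented_arc(1,2)[OF \<gamma>(1)]] by blast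
  show ?thesis
    using that[OF K(1)] K(2)[OF a(1) a(1)] a(2) by simp
qed

lemma time_node_below:
  assumes "t0 \<in> {0..T}"
  obtains n where "n \<le> NT m" "tn m n \<le> t0" "t0 - \<tau> m < tn m n"
proof -
  let ?n = "nat \<lfloor>t0 / \<tau> m\<rfloor>"
  have q: "0 \<le> t0 / \<tau> m" using assms tau(1)[of m] by simp
  have tn: "tn m ?n = real ?n * \<tau> m" by (simp add: time_node_def)
  have "real ?n \<le> t0 / \<tau> m" "t0 / \<tau> m < real ?n + 1" using q by linarith+
  then have b: "real ?n * \<tau> m \<le> t0" "t0 < (real ?n + 1) * \<tau> m"
    using tau(1)[of m] by (simp_all only: pos_le_divide_eq pos_divide_less_eq)
  have "real ?n * \<tau> m \<le> real (NT m) * \<tau> m"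
    using b(1) assms num_steps_pos[OF T_pos dt_pos, of m] by simp
  then have "?n \<le> NT m" using tau(1)[of m] by (simp only: mult_le_cancel_right_pos of_nat_le_iff)
  then show ?thesis using b tn by (intro that[of ?n]) (auto simp: algebra_simps)
qed

text \<open>The discrete counterpart of the contact of \<open>u(x, \<sqdot>)\<close> with a line of slope \<open>c'\<close> at \<open>t0\<close>. The term with
  \<open>\<kappa>\<close> makes this contact strict on the left of \<open>t0\<close>, so minimizers for the discrete solutions can only
  accumulate there. Only times up to \<open>t0\<close> are compared; the left side suffices since the
  scheme runs forward in time.\<close>

lemma contact_times:
  assumes x: "x \<in> net_vertices E" and t0: "t0 \<in> {0<..T}"
    and \<delta>: "0 < \<delta>" "\<delta> \<le> t0" and \<kappa>: "0 < \<kappa>"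
    and below: "\<And>t. t \<in> {t0 - \<delta>..t0} \<Longrightarrow> u (x, t0) + c' * (t - t0) + \<kappa> * (t0 - t) \<le> u (x, t)"
  obtains k where
    "\<forall>\<^sub>F m in sequentially. k m \<le> NT m \<and> tn m (k m) \<le> t0 \<and>
      (\<forall>n\<le>NT m. t0 - \<delta> \<le> tn m n \<and> tn m n \<le> t0 \<longrightarrow>
        v m (x, tn m (k m)) + c' * (tn m n - tn m (k m)) \<le> v m (x, tn m n))"
    "(\<lambda>m. tn m (k m)) \<longlonglongrightarrow> t0" "(\<lambda>m. v m (x, tn m (k m))) \<longlonglongrightarrow> u (x, t0)"
proof -
  define W where "W m = {n. n \<le> NT m \<and> t0 - \<delta> \<le> tn m n \<and> tn m n \<le> t0}" for m
  define f where "f m n = v m (x, tn m n) - c' * tn m n" for m n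
  define k where "k m = arg_min_on (f m) (W m)" for m
  obtain K where K: "0 \<le> K" "\<And>s t. s \<in> {0..T} \<Longrightarrow> t \<in> {0..T} \<Longrightarrow> \<bar>u (x, s) - u (x, t)\<bar> \<le> K * \<bar>s - t\<bar>"
    using u_lip_vertex[OF x] by blast
  have tnT: "tn m n \<in> {0..T}" if "n \<le> NT m" for m n
    by (rule time_node_mem[OF T_pos that])
  have good: "k m \<in> W m" "\<And>n. n \<in> W m \<Longrightarrow> f m (k m) \<le> f m n"
    and near: "\<exists>n\<in>W m. t0 - \<tau> m < tn m n" if "dt m < \<delta>" for m
  proof -
    obtain n where n: "n \<le> NT m" "tn m n \<le> t0" "t0 - \<tau> m < tn m n"
      using time_node_below[of t0 m] t0 by auto
    then have "n \<in> W m" using tau(2)[of m] that by (simp add: W_def)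
    then show "\<exists>n\<in>W m. t0 - \<tau> m < tn m n" using n(3) by blast
    have fin: "finite (W m)" by (rule finite_subset[of _ "{..NT m}"]) (auto simp: W_def)
    have ne: "W m \<noteq> {}" using \<open>n \<in> W m\<close> by blast
    show "k m \<in> W m" "\<And>n. n \<in> W m \<Longrightarrow> f m (k m) \<le> f m n"
      unfolding k_def by (rule arg_min_if_finite(1)[OF fin ne], rule arg_min_least[OF fin ne])
  qed
  have small_dt: "\<forall>\<^sub>F m in sequentially. dt m < \<delta>"
    using ev_le_const[OF \<delta>(1), of 1 0] by simp
  have t_lim: "(\<lambda>m. tn m (k m)) \<longlonglongrightarrow> t0"
  proof (rule tendstoI)
    fix e :: real assume e: "0 < e"
    then have pos: "0 < \<kappa> * e / 4" "0 < \<kappa> * e / 2" using \<kappa> by auto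
    show "\<forall>\<^sub>F m in sequentially. dist (tn m (k m)) t0 < e"
      using small_dt ev_close_vertex[OF x pos(1)] ev_le_const[OF pos(2), of "K + \<bar>c'\<bar>" 0]
    proof eventually_elim
      case (elim m)
      obtain n where n: "n \<in> W m" "t0 - \<tau> m < tn m n" using near[OF elim(1)] by blast
      have k: "k m \<le> NT m" "t0 - \<delta> \<le> tn m (k m)" "tn m (k m) \<le> t0"
        using good(1)[OF elim(1)] by (auto simp: W_def)
      have n': "n \<le> NT m" "tn m n \<le> t0" using n(1) by (auto simp: W_def)
      have 1: "u (x, t0) + c' * (tn m (k m) - t0) + \<kappa> * (t0 - tn m (k m)) \<le> u (x, tn m (k m))"
        using k by (intro below) auto
      have 2: "v m (x, tn m (k m)) - c' * tn m (k m) \<le> v m (x, tn m n) - c' * tn m n"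
        using good(2)[OF elim(1) n(1)] by (simp add: f_def)
      have 3: "\<bar>u (x, tn m n) - u (x, t0)\<bar> \<le> K * dt m"
      proof -
        have "\<bar>u (x, tn m n) - u (x, t0)\<bar> \<le> K * \<bar>tn m n - t0\<bar>"
          using tnT[OF n'(1)] t0 by (intro K(2)) auto
        also have "\<dots> \<le> K * dt m"
          using K(1) n(2) n'(2) tau(2)[of m] by (intro mult_left_mono) auto
        finally show ?thesis .
      qed
      have 4: "c' * (t0 - tn m n) \<le> \<bar>c'\<bar> * dt m"
        using n(2) n'(2) tau(2)[of m] by (intro mult_mono) auto
      have "\<kappa> * (t0 - tn m (k m)) < \<kappa> * e"
      proof -
        have 5: "u (x, tn m (k m)) < v m (x, tn m (k m)) + \<kappa> * e / 4"
          "v m (x, tn m n) < u (x, tn m n) + \<kappa> * e / 4"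
          using elim(2)[rule_format, OF k(1)] elim(2)[rule_format, OF n'(1)] by linarith+
        have 6: "K * dt m + \<bar>c'\<bar> * dt m < \<kappa> * e / 2"
          using elim(3) by (simp add: algebra_simps)
        show ?thesis
          using 1 2 3 4 5 6 unfolding right_diff_distrib by linarith
      qed
      then show ?case using \<kappa> k(3) by (simp add: dist_real_def)
    qed
  qed
  have "(\<lambda>m. v m (x, tn m (k m))) \<longlonglongrightarrow> u (x, t0)"
  proof (rule tendstoI)
    fix e :: real assume e: "0 < e"
    have "\<forall>\<^sub>F m in sequentially. dist (tn m (k m)) t0 < e / (2 * (K + 1))"
      using e K(1) by (intro tendstoD[OF t_lim]) auto
    then show "\<forall>\<^sub>F m in sequentially. dist (v m (x, tn m (k m))) (u (x, t0)) < e"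
      using small_dt ev_close_vertex[OF x half_gt_zero[OF e]]
    proof eventually_elim
      case (elim m)
      have k: "k m \<le> NT m" using good(1)[OF elim(2)] by (auto simp: W_def)
      have "\<bar>u (x, tn m (k m)) - u (x, t0)\<bar> \<le> K * \<bar>tn m (k m) - t0\<bar>"
        using tnT[OF k] t0 by (intro K(2)) auto
      also have "\<dots> \<le> (K + 1) * \<bar>tn m (k m) - t0\<bar>" by (intro mult_right_mono) auto
      also have "\<dots> < e / 2"
        using elim(1) K(1) by (simp add: dist_real_def field_simps)
      finally show ?case
        using elim(3)[rule_format, OF k] by (simp add: dist_real_def abs_if split: if_splits)
    qed
  qed
  moreover have "\<forall>\<^sub>F m in sequentially. k m \<le> NT m \<and> tn m (k m) \<le> t0 \<and>
      (\<forall>n\<le>NT m. t0 - \<delta> \<le> tn m n \<and> tn m n \<le> t0 \<longrightarrow>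
        v m (x, tn m (k m)) + c' * (tn m n - tn m (k m)) \<le> v m (x, tn m n))"
    using small_dt
  proof eventually_elim
    case (elim m)
    show ?case
      using good(1)[OF elim] good(2)[OF elim] by (auto simp: W_def f_def algebra_simps)
  qed
  ultimately show ?thesis using t_lim that by blast
qed

end

section \<open>The vertex condition\<close>

context convergent_scheme
begin

text \<open>By definition \<open>crit_value\<close> bounds \<open>- min H\<close> from below at every point of the arc, in particular at
  \<open>x\<close>, and the modification does not increase the Hamiltonian.\<close>

lemma flux_slope:
  assumes x: "x \<in> net_vertices E" and \<gamma>: "\<gamma> \<in> arcs_at Ep x" and c': "c' < c x"
  obtains \<mu>0 where "H \<gamma> (arc_inv \<gamma> x) \<mu>0 + c' < 0"
proof -
  let ?\<sigma> = "arc_inv \<gamma> x"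
  note \<gamma>' = arcs_atD[OF \<gamma>]
  interpret mh: modified_hamiltonian Ht \<gamma> \<beta>\<^sub>0 \<mu>b by (rule modified[OF oriented_arc(1)[OF \<gamma>'(1)]])
  have "finite (arcs_at Ep x)" using finite_arcs(2) by (simp add: arcs_at_def)
  then have "Min (crit_value Ht ` arcs_at Ep x) \<le> crit_value Ht \<gamma>" using \<gamma> by simp
  then have c: "c x \<le> crit_value Ht \<gamma>" using flux x unfolding flux_limiter_def by fastforce
  obtain m M where m: "\<And>s \<mu>. s \<in> {0..alen \<gamma>} \<Longrightarrow> m \<le> H \<gamma> s \<mu>"
    by (rule mh.H_mod_bounds) blast
  have lb: "m \<le> Ht \<gamma> s \<mu>" if "s \<in> {0..alen \<gamma>}" for s \<mu>
    using m[OF that] mh.H_mod_le[OF that] order_trans by blast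
  have "continuous_on {0..alen \<gamma>} (\<lambda>s. Ht \<gamma> s 0)"
    using continuous_on_compose2[OF mh.Ht_cont, of "{0..alen \<gamma>}" "\<lambda>s. (s, 0)"]
    by (simp add: continuous_on_Pair image_subset_iff)
  then have "bdd_above ((\<lambda>s. Ht \<gamma> s 0) ` {0..alen \<gamma>})"
    by (intro bounded_imp_bdd_above compact_imp_bounded compact_continuous_image) auto
  then obtain M0 where M0: "\<And>s. s \<in> {0..alen \<gamma>} \<Longrightarrow> Ht \<gamma> s 0 \<le> M0"
    unfolding bdd_above_def by blast
  have bddb: "bdd_below (range (Ht \<gamma> s))" if "s \<in> {0..alen \<gamma>}" for s
    using lb[OF that] by (intro bdd_belowI[of _ m]) auto
  have "(INF \<mu>. Ht \<gamma> s \<mu>) \<le> M0" if "s \<in> {0..alen \<gamma>}" for s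
    using cINF_lower[OF bddb[OF that], of 0] M0[OF that] by simp
  then have "bdd_above ((\<lambda>s. INF \<mu>. Ht \<gamma> s \<mu>) ` {0..alen \<gamma>})"
    by (intro bdd_aboveI[of _ M0]) auto
  from cSUP_upper[OF \<gamma>'(2) this]
  have "(INF \<mu>. Ht \<gamma> ?\<sigma> \<mu>) \<le> - crit_value Ht \<gamma>" by (simp add: crit_value_def)
  then have "(INF \<mu>. Ht \<gamma> ?\<sigma> \<mu>) < - c'" using c c' by linarith
  then obtain \<mu>0 where "Ht \<gamma> ?\<sigma> \<mu>0 < - c'"
    using cINF_less_iff[OF UNIV_not_empty bddb[OF \<gamma>'(2)]] by auto
  then show ?thesis
    using that[of \<mu>0] mh.H_mod_le[OF \<gamma>'(2), of \<mu>0] by simp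
qed

text \<open>The barrier argument on one arc. The roof is anchored at height \<open>v (x, t\<^sub>k)\<close> and at \<open>(\<sigma>, t\<^sub>k)\<close>; once
  \<open>v\<close> is above it at the nodes of the preceding time, the strict one step estimate at \<open>\<sigma>\<close> gives the
  claim.\<close>

lemma arc_update_exceeds:
  assumes x: "x \<in> net_vertices E" and t0: "t0 \<in> {0<..T}"
    and \<gamma>: "\<gamma> \<in> arcs_at Ep x" and c': "c' < c x"
    and \<delta>: "0 < \<delta>" "\<delta> \<le> t0"
    and contact: "\<forall>\<^sub>F m in sequentially. k m \<le> NT m \<and> tn m (k m) \<le> t0 \<and>
      (\<forall>n\<le>NT m. t0 - \<delta> \<le> tn m n \<and> tn m n \<le> t0 \<longrightarrow>
        v m (x, tn m (k m)) + c' * (tn m n - tn m (k m)) \<le> v m (x, tn m n))"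
    and t_lim: "(\<lambda>m. tn m (k m)) \<longlonglongrightarrow> t0"
    and v_lim: "(\<lambda>m. v m (x, tn m (k m))) \<longlonglongrightarrow> u (x, t0)"
    and \<phi>: "C1_subtangent ({0..alen \<gamma>} \<times> {0..T}) (pullback u \<gamma>) (arc_inv \<gamma> x, t0) \<phi>"
    and strict: "deriv (\<lambda>t. \<phi> (arc_inv \<gamma> x, t)) t0 +
      H \<gamma> (arc_inv \<gamma> x) (deriv (\<lambda>s. \<phi> (s, t0)) (arc_inv \<gamma> x)) < 0"
  shows "\<forall>\<^sub>F m in sequentially. v m (x, tn m (k m))
    < S_arc L (dx m) (dt m) \<gamma> (pullback (v m) \<gamma>) (arc_inv \<gamma> x) (tn m (k m - 1))"
proof -
  define \<sigma> where "\<sigma> = arc_inv \<gamma> x"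
  define p where "p = deriv (\<lambda>t. \<phi> (\<sigma>, t)) t0"
  define q where "q = deriv (\<lambda>s. \<phi> (s, t0)) \<sigma>"
  have \<gamma>p: "\<gamma> \<in> Ep" and \<sigma>: "\<sigma> \<in> {0..alen \<gamma>}" "amap \<gamma> \<sigma> = x"
    using arcs_atD[OF \<gamma>] by (simp_all add: \<sigma>_def)
  note \<gamma>_arc = oriented_arc[OF \<gamma>p]
  interpret mh: modified_hamiltonian Ht \<gamma> \<beta>\<^sub>0 \<mu>b by (rule modified[OF \<gamma>_arc(1)])
  obtain \<mu>0 where \<mu>0: "H \<gamma> \<sigma> \<mu>0 + c' < 0" using flux_slope[OF x \<gamma> c'] unfolding \<sigma>_def by blast
  obtain \<epsilon> where \<epsilon>: "0 < \<epsilon>" "H \<gamma> \<sigma> (q + \<epsilon>) + (p + \<epsilon>) < 0" "H \<gamma> \<sigma> (q - \<epsilon>) + (p + \<epsilon>) < 0"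
  proof -
    define \<omega> where "\<omega> = - (p + H \<gamma> \<sigma> q) / 2"
    have \<omega>: "0 < \<omega>" using strict by (simp add: \<omega>_def p_def q_def \<sigma>_def)
    obtain d where d: "0 < d" "\<And>r. \<bar>r - q\<bar> < d \<Longrightarrow> \<bar>H \<gamma> \<sigma> r - H \<gamma> \<sigma> q\<bar> < \<omega>"
      using mh.isCont_H_mod[OF \<sigma>(1), of q] \<omega> unfolding continuous_at_eps_delta dist_real_def by blast
    define \<epsilon> where "\<epsilon> = min (d / 2) (\<omega> / 2)"
    have "0 < \<epsilon>" "\<epsilon> < d" "\<epsilon> < \<omega>" using d(1) \<omega> by (auto simp: \<epsilon>_def)
    moreover have "H \<gamma> \<sigma> q = - p - 2 * \<omega>" by (simp add: \<omega>_def field_simps)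
    ultimately show ?thesis
      using d(2)[of "q + \<epsilon>"] d(2)[of "q - \<epsilon>"] by (intro that[of \<epsilon>]) auto
  qed
  \<comment> \<open>The first two pairs share the time slope; their minimum is
    \<open>(p + \<epsilon>) \<theta> + q z - \<epsilon> \<bar>z\<bar>\<close>, which for \<open>\<theta> \<le> 0\<close> is below the expansion of \<open>\<phi>\<close> by \<open>\<epsilon> (\<bar>z\<bar> + \<bar>\<theta>\<bar>)\<close>.
    Both signs of \<open>z\<close> are covered, since \<open>x\<close> may be either end of the arc.\<close>
  define F where "F = {(p + \<epsilon>, q + \<epsilon>), (p + \<epsilon>, q - \<epsilon>), (c', \<mu>0)}"
  have F: "finite F" "F \<noteq> {}" by (simp_all add: F_def)
  have "H \<gamma> \<sigma> m + l < 0" if "(l, m) \<in> F" for l m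
    using that \<epsilon> \<mu>0 by (auto simp: F_def)
  from mh.strict_subsolution_slopes_near[OF \<sigma>(1) F(1) this] obtain \<eta> where \<eta>: "0 < \<eta>"
    "\<And>s l m. s \<in> {0..alen \<gamma>} \<Longrightarrow> \<bar>s - \<sigma>\<bar> < \<eta> \<Longrightarrow> (l, m) \<in> F \<Longrightarrow> H \<gamma> s m + l \<le> - \<eta>" by blast
  define K where "K = Max ((\<lambda>(l, m). max \<bar>l\<bar> \<bar>m\<bar>) ` F)"
  have K: "\<bar>l\<bar> \<le> K \<and> \<bar>m\<bar> \<le> K" if "(l, m) \<in> F" for l m
  proof -
    have "(\<lambda>(l, m). max \<bar>l\<bar> \<bar>m\<bar>) (l, m) \<le> K"
      unfolding K_def using F that by (intro Max_ge) blast+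
    then show ?thesis by simp
  qed
  obtain d where d: "0 < d" "\<And>s t. s \<in> {0..alen \<gamma>} \<Longrightarrow> t \<in> {0..T} \<Longrightarrow> \<bar>s - \<sigma>\<bar> < d \<Longrightarrow> \<bar>t - t0\<bar> < d \<Longrightarrow>
      u (x, t0) + p * (t - t0) + q * (s - \<sigma>) - \<epsilon> / 2 * (\<bar>s - \<sigma>\<bar> + \<bar>t - t0\<bar>) \<le> u (amap \<gamma> s, t)"
  proof -
    obtain d where d: "0 < d" "\<And>s t. (s, t) \<in> {0..alen \<gamma>} \<times> {0..T} \<Longrightarrow> \<bar>s - \<sigma>\<bar> < d \<Longrightarrow> \<bar>t - t0\<bar> < d \<Longrightarrow>
        pullback u \<gamma> (\<sigma>, t0) + p * (t - t0) + q * (s - \<sigma>) - \<epsilon> / 2 * (\<bar>s - \<sigma>\<bar> + \<bar>t - t0\<bar>)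
          \<le> pullback u \<gamma> (s, t)"
      using C1_subtangent_plane_expansion[OF \<phi>[folded \<sigma>_def] half_gt_zero[OF \<epsilon>(1)]]
      unfolding p_def q_def by blast
    show ?thesis
      using d(2) \<sigma>(2) by (intro that[OF d(1)]) (simp add: pullback_def)
  qed
  obtain \<rho>' where \<rho>': "0 < \<rho>'"
    "\<And>s. s \<in> {0..alen \<gamma>} \<Longrightarrow> amap \<gamma> s \<in> net_vertices E \<Longrightarrow> s \<noteq> \<sigma> \<Longrightarrow> \<rho>' \<le> \<bar>s - \<sigma>\<bar>"
  proof -
    have "inj_on (amap \<gamma>) {0..alen \<gamma>}" using \<gamma>_arc(2) by (simp add: regular_arc_def)
    then have "finite (amap \<gamma> -` net_vertices E \<inter> {0..alen \<gamma>})"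
      by (intro finite_vimage_IntI finite_arcs)
    from finite_set_avoid[OF this, of \<sigma>] show ?thesis
      using that by (fastforce simp: dist_real_def abs_minus_commute)
  qed
  \<comment> \<open>The barrier is compared with \<open>v\<close> for \<open>\<bar>s - \<sigma>\<bar> \<le> 2 \<rho>\<close> and \<open>t \<ge> t0 - 2 \<delta>'\<close>. The outer half of this
    region is the far zone, where the expansion of \<open>\<phi>\<close> leaves the gap \<open>\<kappa>\<close>; it is wide enough to catch
    one step of the scheme that starts in the inner half.\<close>
  define \<rho> where "\<rho> = min (min d \<rho>') \<eta> / 4"
  define \<delta>' where "\<delta>' = min \<delta> d / 4"
  have \<rho>: "0 < \<rho>" "2 * \<rho> < d" "\<rho> < \<rho>'" "\<rho> < \<eta>"
    using d(1) \<rho>'(1) \<eta>(1) by (auto simp: \<rho>_def min_def)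
  have \<delta>': "0 < \<delta>'" "2 * \<delta>' < d" "2 * \<delta>' \<le> \<delta>"
    using d(1) \<delta>(1) by (auto simp: \<delta>'_def min_def)
  define \<kappa> where "\<kappa> = \<epsilon> / 2 * min \<rho> \<delta>'"
  have \<kappa>: "0 < \<kappa>" using \<epsilon>(1) \<rho>(1) \<delta>'(1) by (simp add: \<kappa>_def)
  have "(\<lambda>m. (p + \<epsilon>) * (tn m (k m) - t0)) \<longlonglongrightarrow> (p + \<epsilon>) * (t0 - t0)"
    by (intro tendsto_intros t_lim)
  then have ev_shift: "\<forall>\<^sub>F m in sequentially. (p + \<epsilon>) * (tn m (k m) - t0) > - (\<kappa> / 4)"
    using \<kappa> by (intro order_tendstoD(1)) auto
  have ev_v: "\<forall>\<^sub>F m in sequentially. v m (x, tn m (k m)) < u (x, t0) + \<kappa> / 4"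
    using \<kappa> by (intro order_tendstoD(2)[OF v_lim]) simp
  have ev_t: "\<forall>\<^sub>F m in sequentially. t0 - \<delta>' < tn m (k m)"
    using \<delta>'(1) by (intro order_tendstoD(1)[OF t_lim]) simp
  have ev_u: "\<forall>\<^sub>F m in sequentially. \<forall>i\<le>NC \<gamma> m. \<forall>n\<le>NT m.
    \<bar>v m (amap \<gamma> (nd \<gamma> m i), tn m n) - u (amap \<gamma> (nd \<gamma> m i), tn m n)\<bar> < \<kappa> / 4"
    using \<kappa> by (intro ev_close[OF \<gamma>p]) simp
  have ev_dt: "\<forall>\<^sub>F m in sequentially. 1 * dt m + 0 * dx m < \<delta>'"
    by (rule ev_le_const[OF \<delta>'(1)])
  from contact ev_shift ev_v ev_t ev_u ev_dt ev_le_const[OF \<rho>(1), of \<beta>\<^sub>0 1] ev_mesh_error[OF \<eta>(1), of K]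
  show ?thesis
  proof eventually_elim
    case (elim m)
    let ?k = "k m" and ?C = "v m (x, tn m (k m))"
    have k: "?k \<le> NT m" "tn m ?k \<le> t0" using elim(1) by auto
    have dt_small: "dt m < \<delta>'" "\<tau> m \<le> \<delta>'" using elim(6) tau(2)[of m] by auto
    have reach: "\<beta>\<^sub>0 * dt m + dx m \<le> \<rho>" using elim(7) by simp
    have step: "?C + roof F (\<theta> + \<tau> m) (s - \<sigma>) < S_arc L (dx m) (dt m) \<gamma> (pullback (v m) \<gamma>) s (tn m n)"
      if s: "s \<in> {0..alen \<gamma>}" "\<bar>s - \<sigma>\<bar> < \<rho>"
        and w: "\<And>i. i \<le> NC \<gamma> m \<Longrightarrow> \<bar>nd \<gamma> m i - \<sigma>\<bar> \<le> 2 * \<rho> \<Longrightarrow>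
          ?C + roof F \<theta> (nd \<gamma> m i - \<sigma>) \<le> v m (amap \<gamma> (nd \<gamma> m i), tn m n)" for s \<theta> n
    proof (rule mh.S_arc_gt_roof[where R = "2 * \<rho>" and K = K and \<eta> = \<eta>])
      show "H \<gamma> s m + l \<le> - \<eta> \<and> \<bar>l\<bar> \<le> K \<and> \<bar>m\<bar> \<le> K" if "(l, m) \<in> F" for l m
        using \<eta>(2)[OF s(1) _ that] K[OF that] s(2) \<rho>(4) by simp
      show "\<bar>s - \<sigma>\<bar> + \<beta>\<^sub>0 * dt m + dx m \<le> 2 * \<rho>" using reach s(2) by linarith
      show "?C + roof F \<theta> (nd \<gamma> m i - \<sigma>) \<le> pullback (v m) \<gamma> (nd \<gamma> m i, tn m n)"
        if "i \<le> NC \<gamma> m" "\<bar>nd \<gamma> m i - \<sigma>\<bar> \<le> 2 * \<rho>" for i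
        using w[OF that] by (simp add: pullback_def)
    qed (use F s elim(8) tau(2)[of m] dx_pos dt_pos \<gamma>_arc(3) in simp_all)
    have barrier: "n < ?k \<Longrightarrow> t0 - 2 * \<delta>' \<le> tn m n \<Longrightarrow> i \<le> NC \<gamma> m \<Longrightarrow> \<bar>nd \<gamma> m i - \<sigma>\<bar> \<le> 2 * \<rho> \<Longrightarrow>
        ?C + roof F (tn m n - tn m ?k) (nd \<gamma> m i - \<sigma>) \<le> v m (amap \<gamma> (nd \<gamma> m i), tn m n)" for n i
    proof (induction n arbitrary: i rule: less_induct)
      case (less n i)
      let ?s = "nd \<gamma> m i" and ?t = "tn m n"
      have s: "?s \<in> {0..alen \<gamma>}" by (rule node_mem[OF \<gamma>_arc(3) less.prems(3)])
      have n: "n \<le> NT m" "?t < tn m ?k" using less.prems(1) k(1) tn_less by auto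
      have t: "?t \<in> {0..T}" by (rule time_node_mem[OF T_pos n(1)])
      consider (far) "\<rho> \<le> \<bar>?s - \<sigma>\<bar> \<or> ?t \<le> t0 - \<delta>'" | (vertex) "?s = \<sigma>"
        | (near) "\<bar>?s - \<sigma>\<bar> < \<rho>" "t0 - \<delta>' < ?t" "?s \<noteq> \<sigma>" by linarith
      then show ?case
      proof cases
        case far
        \<comment> \<open>Half of the gap \<open>\<epsilon> (\<bar>s - \<sigma>\<bar> + \<bar>t - t0\<bar>)\<close> absorbs the remainder of the expansion; the other half
          is at least \<open>\<kappa>\<close> and absorbs the three errors, of size at most \<open>\<kappa> / 4\<close> each: distance of
          \<open>v\<close> from \<open>u\<close>, of \<open>v (x, t\<^sub>k)\<close> from \<open>u (x, t0)\<close>, and of \<open>t\<^sub>k\<close> from \<open>t0\<close>.\<close>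
        have "\<kappa> \<le> \<epsilon> / 2 * (\<bar>?s - \<sigma>\<bar> + \<bar>?t - t0\<bar>)"
          unfolding \<kappa>_def using far \<epsilon>(1) \<delta>'(1) by (intro mult_left_mono) auto
        moreover have "u (x, t0) + p * (?t - t0) + q * (?s - \<sigma>) - \<epsilon> / 2 * (\<bar>?s - \<sigma>\<bar> + \<bar>?t - t0\<bar>)
            \<le> u (amap \<gamma> ?s, ?t)"
          using less.prems n k \<rho> \<delta>' by (intro d(2)[OF s t]) auto
        moreover have "u (amap \<gamma> ?s, ?t) - \<kappa> / 4 < v m (amap \<gamma> ?s, ?t)"
          using elim(5)[rule_format, OF less.prems(3) n(1)] by linarith
        moreover have "roof F (?t - tn m ?k) (?s - \<sigma>)
            \<le> (p + \<epsilon>) * (?t - tn m ?k) + (q * (?s - \<sigma>) - \<epsilon> * \<bar>?s - \<sigma>\<bar>)"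
        proof (cases "\<sigma> \<le> ?s")
          case True
          have "(p + \<epsilon>, q - \<epsilon>) \<in> F" by (simp add: F_def)
          from roof_le[OF F(1) this, of "?t - tn m ?k" "?s - \<sigma>"] show ?thesis
            using True by (simp add: algebra_simps)
        next
          case False
          have "(p + \<epsilon>, q + \<epsilon>) \<in> F" by (simp add: F_def)
          from roof_le[OF F(1) this, of "?t - tn m ?k" "?s - \<sigma>"] show ?thesis
            using False by (simp add: algebra_simps)
        qed
        moreover have "(p + \<epsilon>) * (?t - tn m ?k)
            = p * (?t - t0) - \<epsilon> * \<bar>?t - t0\<bar> - (p + \<epsilon>) * (tn m ?k - t0)"
          using n(2) k(2) by (simp add: algebra_simps)
        moreover have "\<epsilon> / 2 * (\<bar>?s - \<sigma>\<bar> + \<bar>?t - t0\<bar>)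
            = \<epsilon> * \<bar>?s - \<sigma>\<bar> + \<epsilon> * \<bar>?t - t0\<bar> - \<epsilon> / 2 * (\<bar>?s - \<sigma>\<bar> + \<bar>?t - t0\<bar>)"
          by (simp add: algebra_simps)
        ultimately show ?thesis using elim(2,3) \<kappa> by linarith
      next
        case vertex
        have "?C + c' * (?t - tn m ?k) \<le> v m (x, ?t)"
          using elim(1) less.prems(2) n k \<delta>'(3) by auto
        moreover have "roof F (?t - tn m ?k) 0 \<le> c' * (?t - tn m ?k) + \<mu>0 * 0"
          by (rule roof_le[OF F(1)]) (simp add: F_def)
        ultimately show ?thesis by (simp add: vertex \<sigma>(2))
      next
        case near
        have "n \<noteq> 0" using near(2) \<delta>' \<delta> tn_0[of m] by (cases "n = 0") auto
        then obtain n' where n': "n = Suc n'" using not0_implies_Suc by blast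
        have t': "?t = tn m n' + \<tau> m" by (simp add: n' tn_Suc)
        have "amap \<gamma> ?s \<notin> net_vertices E"
          using \<rho>'(2)[OF s _ near(3)] near(1) \<rho>(3) by linarith
        then have "v m (amap \<gamma> ?s, ?t) = S_arc L (dx m) (dt m) \<gamma> (pullback (v m) \<gamma>) ?s (tn m n')"
          using scheme_step_interior[OF \<gamma>p less.prems(3)] n(1) by (simp add: n')
        moreover have "?C + roof F ((tn m n' - tn m ?k) + \<tau> m) (?s - \<sigma>)
            < S_arc L (dx m) (dt m) \<gamma> (pullback (v m) \<gamma>) ?s (tn m n')"
        proof (rule step[OF s near(1)])
          have "t0 - 2 * \<delta>' \<le> tn m n'" using near(2) t' dt_small(2) by linarith
          then show "?C + roof F (tn m n' - tn m ?k) (nd \<gamma> m j - \<sigma>) \<le> v m (amap \<gamma> (nd \<gamma> m j), tn m n')"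
            if "j \<le> NC \<gamma> m" "\<bar>nd \<gamma> m j - \<sigma>\<bar> \<le> 2 * \<rho>" for j
            using less.IH[of n' j] less.prems(1) that n' by simp
        qed
        moreover have "(tn m n' - tn m ?k) + \<tau> m = ?t - tn m ?k" using t' by simp
        ultimately show ?thesis by simp
      qed
    qed
    have k_pos: "?k \<noteq> 0"
      using elim(4) \<delta>' \<delta> tn_0[of m] by (cases "?k = 0") auto
    then have k_Suc: "?k = Suc (?k - 1)" by simp
    then have prev: "tn m (?k - 1) + \<tau> m = tn m ?k" using tn_Suc[of m "?k - 1"] by simp
    have "?C + roof F ((tn m (?k - 1) - tn m ?k) + \<tau> m) (\<sigma> - \<sigma>)
        < S_arc L (dx m) (dt m) \<gamma> (pullback (v m) \<gamma>) \<sigma> (tn m (?k - 1))"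
      by (rule step) (use \<sigma>(1) \<rho>(1) k_pos prev elim(4) dt_small(2) in \<open>auto intro!: barrier\<close>)
    moreover have "(tn m (?k - 1) - tn m ?k) + \<tau> m = 0" using prev by simp
    moreover have "roof F 0 0 = 0"
      using roof_attained[OF F, of 0 0] by auto
    ultimately show ?case by (simp add: \<sigma>_def)
  qed
qed

text \<open>At a contact time, neither the flux limiter term nor any arc can attain the minimum in the vertex
  update.\<close>

lemma supersolution_at_vertex:
  assumes x: "x \<in> net_vertices E" and t0: "t0 \<in> {0<..T}"
    and \<psi>: "C1_subtangent {0..T} (\<lambda>t. u (x, t)) t0 \<psi>" "deriv \<psi> t0 < c x"
  shows "\<exists>\<gamma>\<in>arcs_at Ep x. \<forall>\<phi>.
    C1_subtangent ({0..alen \<gamma>} \<times> {0..T}) (pullback u \<gamma>) (arc_inv \<gamma> x, t0) \<phi> \<longrightarrow>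
    0 \<le> deriv (\<lambda>t. \<phi> (arc_inv \<gamma> x, t)) t0 +
      H \<gamma> (arc_inv \<gamma> x) (deriv (\<lambda>s. \<phi> (s, t0)) (arc_inv \<gamma> x))"
proof (rule ccontr)
  assume neg: "\<not> ?thesis"
  define a where "a = deriv \<psi> t0"
  define c' where "c' = (a + c x) / 2"
  define \<kappa> where "\<kappa> = (c' - a) / 2"
  have c': "c' < c x" and \<kappa>: "0 < \<kappa>" using \<psi>(2) by (simp_all add: c'_def \<kappa>_def a_def field_simps)
  obtain d where d: "0 < d" "\<And>t. t \<in> {0..T} \<Longrightarrow> \<bar>t - t0\<bar> < d \<Longrightarrow>
      u (x, t0) + a * (t - t0) - \<kappa> * \<bar>t - t0\<bar> \<le> u (x, t)"
    using C1_subtangent_real_expansion[OF \<psi>(1) \<kappa>] unfolding a_def by blast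
  define \<delta> where "\<delta> = min (d / 2) t0"
  have \<delta>: "0 < \<delta>" "\<delta> \<le> t0" "\<delta> < d" using d(1) t0 by (auto simp: \<delta>_def)
  have below: "u (x, t0) + c' * (t - t0) + \<kappa> * (t0 - t) \<le> u (x, t)" if t: "t \<in> {t0 - \<delta>..t0}" for t
  proof -
    have "u (x, t0) + a * (t - t0) - \<kappa> * \<bar>t - t0\<bar> \<le> u (x, t)"
      using t \<delta> t0 by (intro d(2)) auto
    moreover have "a = c' - 2 * \<kappa>" by (simp add: \<kappa>_def field_simps)
    ultimately show ?thesis using t by (simp add: algebra_simps)
  qed
  obtain k where contact: "\<forall>\<^sub>F m in sequentially. k m \<le> NT m \<and> tn m (k m) \<le> t0 \<and>
      (\<forall>n\<le>NT m. t0 - \<delta> \<le> tn m n \<and> tn m n \<le> t0 \<longrightarrow>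
        v m (x, tn m (k m)) + c' * (tn m n - tn m (k m)) \<le> v m (x, tn m n))"
    and lims: "(\<lambda>m. tn m (k m)) \<longlonglongrightarrow> t0" "(\<lambda>m. v m (x, tn m (k m))) \<longlonglongrightarrow> u (x, t0)"
    using contact_times[OF x t0 \<delta>(1,2) \<kappa> below] by blast
  have fin: "finite (arcs_at Ep x)" using finite_arcs(2) by (simp add: arcs_at_def)
  have "\<forall>\<gamma>\<in>arcs_at Ep x. \<forall>\<^sub>F m in sequentially. v m (x, tn m (k m))
      < S_arc L (dx m) (dt m) \<gamma> (pullback (v m) \<gamma>) (arc_inv \<gamma> x) (tn m (k m - 1))"
  proof
    fix \<gamma> assume \<gamma>: "\<gamma> \<in> arcs_at Ep x"
    then obtain \<phi> where "C1_subtangent ({0..alen \<gamma>} \<times> {0..T}) (pullback u \<gamma>) (arc_inv \<gamma> x, t0) \<phi>"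
      "deriv (\<lambda>t. \<phi> (arc_inv \<gamma> x, t)) t0 +
        H \<gamma> (arc_inv \<gamma> x) (deriv (\<lambda>s. \<phi> (s, t0)) (arc_inv \<gamma> x)) < 0"
      using neg unfolding bex_simps not_all not_imp not_le by blast
    then show "\<forall>\<^sub>F m in sequentially. v m (x, tn m (k m))
      < S_arc L (dx m) (dt m) \<gamma> (pullback (v m) \<gamma>) (arc_inv \<gamma> x) (tn m (k m - 1))"
      by (rule arc_update_exceeds[OF x t0 \<gamma> c' \<delta>(1,2) contact lims])
  qed
  then have ev_arcs: "\<forall>\<^sub>F m in sequentially. \<forall>\<gamma>\<in>arcs_at Ep x. v m (x, tn m (k m))
      < S_arc L (dx m) (dt m) \<gamma> (pullback (v m) \<gamma>) (arc_inv \<gamma> x) (tn m (k m - 1))"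
    by (rule eventually_ball_finite[OF fin])
  have ev_t: "\<forall>\<^sub>F m in sequentially. t0 - \<delta> / 2 < tn m (k m)"
    using \<delta>(1) by (intro order_tendstoD(1)[OF lims(1)]) simp
  have ev_dt: "\<forall>\<^sub>F m in sequentially. 1 * dt m + 0 * dx m < \<delta> / 2"
    using \<delta>(1) by (intro ev_le_const) simp
  \<comment> \<open>The update adds \<open>c x * dt\<close> while the time node advances only by \<open>\<tau>\<close>; the mesh error bound absorbs
    the difference.\<close>
  have ev_drift: "\<forall>\<^sub>F m in sequentially. \<bar>c'\<bar> * dx m + \<bar>c'\<bar> * (dt m - \<tau> m) < (c x - c') * dt m"
    using ev_mesh_error[of "c x - c'" "\<bar>c'\<bar>"] c' by simp
  have "\<forall>\<^sub>F m in sequentially. False"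
    using contact ev_arcs ev_t ev_dt ev_drift
  proof eventually_elim
    case (elim m)
    let ?k = "k m"
    have k: "?k \<le> NT m" "tn m ?k \<le> t0" using elim(1) by auto
    have "?k \<noteq> 0" using elim(3) \<delta> tn_0[of m] by (cases "?k = 0") auto
    then obtain n where n: "?k = Suc n" using not0_implies_Suc by blast
    have t: "tn m ?k = tn m n + \<tau> m" by (simp add: n tn_Suc)
    have "t0 - \<delta> \<le> tn m n" "tn m n \<le> t0" "n \<le> NT m"
      using t k n elim(3,4) tau(1,2)[of m] by auto
    then have "v m (x, tn m ?k) + c' * (tn m n - tn m ?k) \<le> v m (x, tn m n)" using elim(1) by blast
    then have "v m (x, tn m ?k) \<le> v m (x, tn m n) + c' * \<tau> m" by (simp add: t)
    also have "c' * \<tau> m < c x * dt m"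
    proof -
      have "- c' * (dt m - \<tau> m) \<le> \<bar>c'\<bar> * (dt m - \<tau> m)"
        using tau(2)[of m] by (intro mult_right_mono) auto
      moreover have "0 \<le> \<bar>c'\<bar> * dx m" using dx_pos[of m] by simp
      ultimately show ?thesis using elim(5) by (simp add: algebra_simps)
    qed
    finally have flux_inactive: "v m (x, tn m ?k) < v m (x, tn m n) + c x * dt m" by simp
    obtain \<eta> i where \<eta>: "\<eta> \<in> Ep" "i \<le> NC \<eta> m" "amap \<eta> (nd \<eta> m i) = x"
      using vertex_is_node[OF x] by metis
    then have xg: "x \<in> space_grid Ep (dx m)" using node_in_space_grid by blast
    have "\<eta> \<in> arcs_at Ep x"
      using \<eta> node_mem[OF oriented_arc(3)[OF \<eta>(1)] \<eta>(2)] by (auto simp: arcs_at_def support_def)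
    then have "Min ((\<lambda>\<gamma>. S_arc L (dx m) (dt m) \<gamma> (pullback (v m) \<gamma>) (arc_inv \<gamma> x) (tn m n)) ` arcs_at Ep x)
        > v m (x, tn m ?k)"
      using elim(2) fin by (subst Min_gr_iff) (auto simp: n)
    then have "v m (x, tn m ?k) < S_net E Ep c L (dx m) (dt m) (v m) x (tn m n)"
      using flux_inactive x by (simp add: S_net_def)
    then show False using scheme_step[OF xg, of n] k(1) by (simp add: n)
  qed
  then show False by simp
qed

end

theorem theorem8p3:
  fixes E Ep :: "'a::euclidean_space net_arc set"
    and Ht :: "'a hamiltonian"
    and c g :: "'a \<Rightarrow> real"
    and T \<beta> \<beta>\<^sub>0 \<mu>b :: real
    and J Jt :: "real set"
    and dx dt :: "nat \<Rightarrow> real"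
    and v :: "nat \<Rightarrow> 'a \<times> real \<Rightarrow> real"
    and u :: "'a \<times> real \<Rightarrow> real"
    and r :: "nat \<Rightarrow> nat"
  assumes "network E" and "orientation E Ep"
    and "hamiltonians E Ht"
    and "flux_limiter E Ep Ht c"
    and "lipschitz_wrt (geo_dist E) (net_points E) g"
    and "0 < T"
    and "modification_data E Ht c g J Jt \<beta> \<beta>\<^sub>0 \<mu>b"
    and "\<And>m. admissible Ep T (dx m) (dt m)"
    and "dx \<longlonglongrightarrow> 0" and "dt \<longlonglongrightarrow> 0"
    and "(\<lambda>m. dx m / dt m) \<longlonglongrightarrow> 0"
    and "\<And>m. discrete_solution E Ep c (L_mod Ht \<beta>\<^sub>0 \<mu>b) g T (dx m) (dt m) (v m)"
    and "lipschitz_wrt (geo_time_dist E) (net_points E \<times> {0..T}) u"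
    and "strict_mono r"
    and "converges_uniformly (geo_time_dist E)
           (\<lambda>m. grid Ep T (dx (r m)) (dt (r m))) (\<lambda>m. v (r m)) (net_points E \<times> {0..T}) u"
  shows "\<forall>x\<in>net_vertices E. \<forall>t\<^sub>0\<in>{0<..T}.
           (\<exists>\<psi>. C1_subtangent {0..T} (\<lambda>t. u (x, t)) t\<^sub>0 \<psi> \<and> deriv \<psi> t\<^sub>0 < c x) \<longrightarrow>
           (\<exists>\<gamma>\<in>arcs_at Ep x. \<forall>\<phi>.
              C1_subtangent ({0..alen \<gamma>} \<times> {0..T}) (pullback u \<gamma>) (arc_inv \<gamma> x, t\<^sub>0) \<phi> \<longrightarrow>
              deriv (\<lambda>t. \<phi> (arc_inv \<gamma> x, t)) t\<^sub>0 +
                H_mod Ht \<beta>\<^sub>0 \<mu>b \<gamma> (arc_inv \<gamma> x) (deriv (\<lambda>s. \<phi> (s, t\<^sub>0)) (arc_inv \<gamma> x)) \<ge> 0)"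
proof -
  have modified: "modified_hamiltonian Ht \<gamma> \<beta>\<^sub>0 \<mu>b" if \<gamma>: "\<gamma> \<in> E" for \<gamma>
  proof
    show "continuous_on ({0..alen \<gamma>} \<times> UNIV) (\<lambda>(s, \<mu>). Ht \<gamma> s \<mu>)"
      using assms(3) \<gamma> unfolding hamiltonians_def by blast
    have "\<beta>-lipschitz_on ({0..alen \<gamma>} \<times> Jt) (\<lambda>(s, \<mu>). Ht \<gamma> s \<mu>)" "\<beta> < \<beta>\<^sub>0"
      using assms(7) \<gamma> unfolding modification_data_def by blast+
    then show "0 < \<beta>\<^sub>0" using lipschitz_on_nonneg by fastforce
  qed (use assms(7) \<gamma> in \<open>auto simp: modification_data_def\<close>)
  interpret convergent_scheme E Ep Ht c g T \<beta>\<^sub>0 \<mu>b "dx \<circ> r" "dt \<circ> r" "v \<circ> r" u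
  proof (rule convergent_scheme.intro)
    show "(dx \<circ> r) \<longlonglongrightarrow> 0" "(dt \<circ> r) \<longlonglongrightarrow> 0"
      using assms(9,10,14) by (simp_all add: LIMSEQ_subseq_LIMSEQ)
    show "(\<lambda>m. (dx \<circ> r) m / (dt \<circ> r) m) \<longlonglongrightarrow> 0"
      using LIMSEQ_subseq_LIMSEQ[OF assms(11,14)] by (simp add: o_def)
  qed (use assms modified in \<open>simp_all add: o_def\<close>)
  show ?thesis
    using supersolution_at_vertex by blast
qed

end
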